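(* Let $P,Q$ be nonzero integers with $D=P^2-4Q\neq 0$, such that the Lucas sequence $U=U(P,Q)$ is nondegenerate. Fix a prime $p$ and a positive integer $n$ with $(p,n)=1$. If $p\nmid (P,Q)$, the following congruences hold. (a) If $p\mid D$, then for all $k\ge 1$, $$M^U_{p^kn}\equiv\begin{cases} p \pmod{p^k}, & n=1,\\ 1\pmod{p^k}, & n>1.\end{cases}$$ If $p=2$, then moreover $M^U_{2^k}\equiv 2\pmod{2^{k+1}}$ when $n=1$ and $k\ge 3$, and $M^U_{2^kn}\equiv 1\pmod{2^{k+1}}$ when $n>1$ and $k\ge 2$. If $p>2$ and $n=1$, then $M^U_{p^k}\equiv p\pmod{p^{k+1}}$ for all $k\ge 2$ if $p=3$, and for all $k\ge 1$ if $p>3$. (b) If $p\nmid D$, then for all $k\ge 1$, $$M^U_{p^kn}\equiv\begin{cases} \left(\frac{D}{p}\right) \pmod{p^k}, & n=1,\\ 1\pmod{p^k}, & n>1,\end{cases}$$ unless $n=z_U(p)$, in which case $M^U_{p^kz_U(p)}\equiv \left(\frac{D}{p}\right)p\pmod{p^k}$ for all $k\ge1$, with the stronger congruence $M^U_{p^kz_U(p)}\equiv \left(\frac{D}{p}\right)p\pmod{p^{k+1}}$ for all $k\ge 2$ if $p=2$, and for all $k\ge 1$ if $p>2$. If instead $p\mid (P,Q)$, then: (c) For all $k\ge 1$, $M^U_{p^kn}\equiv 0\pmod{p^{p^{k-1}}}$, unless $2v_p(P)>v_p(Q)$, $p=2$ and $n=1$, in which case one has (only) $M^U_{2^k}\equiv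 0\pmod{2^{2^{k-2}+1}}$ for $k\ge 2$.
   Context: For nonzero integers $P,Q$ with $D=P^2-4Q\ne0$, let $\alpha=(P+\sqrt D)/2$, $\beta=(P-\sqrt D)/2$ and define the Lucas sequences $U_n=(\alpha^n-\beta^n)/(\alpha-\beta)$, $V_n=\alpha^n+\beta^n$ ($n\ge0$). $U$ is nondegenerate if $U_n\neq0$ for all $n\ge1$ (equivalently $\alpha/\beta$ is not a root of unity). The Möbius dual sequence is $M^U_n=\prod_{d\mid n}U_d^{\mu(n/d)}$ (an integer for all $n\ge1$), where $\mu$ is the Möbius function. For a prime $p$, the entry point $z_U(p)$ is the least $n\ge1$ with $p\mid U_n$ (it exists unless $p\nmid P$ and $p\mid Q$). $(P,Q)$ denotes $\gcd(P,Q)$, $v_p$ is the $p$-adic valuation, and $\left(\frac{\cdot}{\cdot}\right)$ is the Kronecker symbol. *)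

theory Defs
  imports
    "HOL-Number_Theory.Number_Theory"
    "HOL-Computational_Algebra.Squarefree"
begin

definition lucas_D :: "int \<Rightarrow> int \<Rightarrow> int" where
  "lucas_D P Q = P\<^sup>2 - 4 * Q"

definition lucas_alpha :: "int \<Rightarrow> int \<Rightarrow> complex" where
  "lucas_alpha P Q = (of_int P + csqrt (of_int (lucas_D P Q))) / 2"

definition lucas_beta :: "int \<Rightarrow> int \<Rightarrow> complex" where
  "lucas_beta P Q = (of_int P - csqrt (of_int (lucas_D P Q))) / 2"

definition lucas_U :: "int \<Rightarrow> int \<Rightarrow> nat \<Rightarrow> complex" where
  "lucas_U P Q n =
     (lucas_alpha P Q ^ n - lucas_beta P Q ^ n) / (lucas_alpha P Q - lucas_beta P Q)"

definition nondegenerate_U :: "int \<Rightarrow> int \<Rightarrow> bool" where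
  "nondegenerate_U P Q \<longleftrightarrow> (\<forall>n\<ge>1. lucas_U P Q n \<noteq> 0)"

definition moebius_mu :: "nat \<Rightarrow> int" where
  "moebius_mu n = (if squarefree n then (- 1) ^ card (prime_factors n) else 0)"

definition moebius_dual_U :: "int \<Rightarrow> int \<Rightarrow> nat \<Rightarrow> complex" where
  "moebius_dual_U P Q n = (\<Prod>d | d dvd n. lucas_U P Q d powi moebius_mu (n div d))"

text \<open>
  The sequences above are complex-valued expressions whose values are integers. Since divisibility
  in the field of complex numbers is trivial, arithmetic statements about them are made
  through the integer they represent; in particular the congruence below
  includes the claim that its left-hand side is an integer.
\<close>

definition int_valued_cong :: "complex \<Rightarrow> int \<Rightarrow> int \<Rightarrow> bool" where
  "int_valued_cong z a m \<longleftrightarrow> (\<exists>x::int. z = of_int x \<and> [x = a] (mod m))"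

definition dvd_U :: "int \<Rightarrow> int \<Rightarrow> nat \<Rightarrow> nat \<Rightarrow> bool" where
  "dvd_U P Q p n \<longleftrightarrow> (\<exists>u::int. lucas_U P Q n = of_int u \<and> int p dvd u)"

text \<open>
  The entry point need not exist (it does not if \<open>p\<close> divides \<open>Q\<close> but not \<open>P\<close>). It is then
  set to \<open>0\<close>, which differs from every index \<open>n \<ge> 1\<close>.
\<close>

definition entry_point_U :: "int \<Rightarrow> int \<Rightarrow> nat \<Rightarrow> nat" where
  "entry_point_U P Q p =
     (if \<exists>n\<ge>1. dvd_U P Q p n then LEAST n. n \<ge> 1 \<and> dvd_U P Q p n else 0)"

text \<open>
  The Kronecker symbol \<open>(a / p)\<close> for prime \<open>p\<close>. The case \<open>p = 2\<close> must be separated, because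
  \<^term>\<open>Legendre a 2\<close> is \<open>1\<close> for every odd \<open>a\<close>.
\<close>

definition kronecker_prime :: "int \<Rightarrow> nat \<Rightarrow> int" where
  "kronecker_prime a p =
     (if p = 2 then
        (if even a then 0 else if a mod 8 = 1 \<or> a mod 8 = 7 then 1 else - 1)
      else Legendre a (int p))"

lemma lucas_U_0: "lucas_U P Q 0 = 0"
  by (simp add: lucas_U_def)

lemma lucas_U_1:
  assumes "lucas_D P Q \<noteq> 0"
  shows "lucas_U P Q 1 = 1"
  using assms by (simp add: lucas_U_def lucas_alpha_def lucas_beta_def field_simps)

lemma lucas_U_rec:
  "lucas_U P Q (Suc (Suc n)) = of_int P * lucas_U P Q (Suc n) - of_int Q * lucas_U P Q n"
proof -
  have s: "lucas_alpha P Q + lucas_beta P Q = of_int P"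
    by (simp add: lucas_alpha_def lucas_beta_def field_simps)
  have "lucas_alpha P Q * lucas_beta P Q
      = ((of_int P)\<^sup>2 - (csqrt (of_int (lucas_D P Q)))\<^sup>2) / 4"
    by (simp add: lucas_alpha_def lucas_beta_def field_simps power2_eq_square)
  also have "\<dots> = of_int Q"
    by (simp add: lucas_D_def)
  finally have p: "lucas_alpha P Q * lucas_beta P Q = of_int Q" .
  show ?thesis
    unfolding lucas_U_def s[symmetric] p[symmetric]
    by (simp add: diff_divide_distrib[symmetric] algebra_simps)
qed

lemma lucas_U_Ints:
  assumes "lucas_D P Q \<noteq> 0"
  shows "lucas_U P Q n \<in> \<int>"
proof (induction n rule: induct_nat_012)
  case 0
  show ?case by (simp add: lucas_U_0)
next
  case 1
  show ?case using lucas_U_1[OF assms] by simp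
next
  case (ge2 n)
  then show ?case by (simp add: lucas_U_rec)
qed

end

(*
  Up to homogenization M_n is the n-th cyclotomic polynomial evaluated at (alpha, beta): it is a
  polynomial with integer coefficients in P and Q, isobaric of weight totient n when P has weight 1
  and Q has weight 2. Its integrality comes from factoring the polynomial U_n(X, 1) over its roots
  2 cos (pi j / n) and dividing monic polynomials.

  For n > 1 prime to p, M_{p^k n} is the quotient of the values of the polynomial M_n at
  (V_{p^k}, Q^(p^k)) and at (V_{p^(k-1)}, Q^(p^(k-1))). These two pairs are congruent modulo p^k, so
  the quotient is 1 modulo p^k as soon as p does not divide M_n(P, Q), which fails only if n is the
  entry point of p. For n = 1 the number M_{p^k} = U_{p^k} / U_{p^(k-1)} is treated directly: if p
  divides D by the expansion of U_p in powers of D, and otherwise because its square is 1 modulo p^k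
  by D U^2 = V^2 - 4 Q^m. The entry point reduces to the case where p divides the discriminant, for
  the parameters (V_n, Q^n). If p divides P and Q, the divisibility is read off from the weights of
  the monomials of M_n.
*)

theory Submission
  imports Defs "HOL-Computational_Algebra.Polynomial"
begin

section \<open>The dual sequence as an integer polynomial\<close>

text \<open>The product defining the dual sequence cannot be reduced modulo p^k factor by factor,
  since p may divide its denominator; an integer polynomial in P and Q can. Its roots come from
  U_n(2 cos t, 1) = sin (n t) / sin t, so real angles take the place of cyclotomic fields. Passing
  from (P, Q) to (V_m, Q^m) multiplies D by U_m^2. If an odd p divides D but not Q, then p^k divides
  U_(p^k), and D at that level is divisible by p^(2 k + 1). In the expansion of U_p the term linear
  in D carries p choose 3, which among odd primes is prime to p only for p = 3: hence the bound k >=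
  2 there. At the entry point D acquires p^2 at once, and this bound disappears. For p = 2 the
  sharper modulus comes from V_(2 m) = V_m^2 - 2 Q^m, where squaring gains a factor 2 in the
  modulus. When p divides P and Q, the exception p = 2, n = 1 is the only case in which half of
  totient (p^k n) falls below p^(k - 1).\<close>

fun lucU :: "int \<Rightarrow> int \<Rightarrow> nat \<Rightarrow> int" where
  "lucU P Q 0 = 0"
| "lucU P Q (Suc 0) = 1"
| "lucU P Q (Suc (Suc n)) = P * lucU P Q (Suc n) - Q * lucU P Q n"

lemma of_int_lucU:
  assumes "lucas_D P Q \<noteq> 0"
  shows "of_int (lucU P Q n) = lucas_U P Q n"
  using lucas_U_1[OF assms]
  by (induction n rule: induct_nat_012) (simp_all add: lucas_U_0 lucas_U_rec)

text \<open>U_n(X, 1), a Chebyshev polynomial of the second kind in X / 2: at X = 2 cos t it takes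
  the value sin (n t) / sin t.\<close>

fun sin_poly :: "nat \<Rightarrow> complex poly" where
  "sin_poly 0 = 0"
| "sin_poly (Suc 0) = 1"
| "sin_poly (Suc (Suc n)) = [:0, 1:] * sin_poly (Suc n) - sin_poly n"

text \<open>For x = exp (pi i j / n) and y = 1 / x this is x + y, and x / y = exp (2 pi i j / n); so
  j coprime to n corresponds to x / y of exact order n.\<close>

definition cos_root :: "nat \<Rightarrow> nat \<Rightarrow> complex" where
  "cos_root n j = of_real (2 * cos (pi * real j / real n))"

text \<open>
  \<open>prim_poly 1\<close> is \<open>X + 2\<close>, not the value \<open>1\<close> of the dual sequence: this extra
  factor makes the product over all divisors work without an exception.
\<close>

definition prim_poly :: "nat \<Rightarrow> complex poly" where
  "prim_poly n = (\<Prod>j\<in>totatives n. [:- cos_root n j, 1:])"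

lemma poly_sin_poly:
  "poly (sin_poly n) (of_real (2 * cos t)) * of_real (sin t) = of_real (sin (real n * t))"
proof (induction n rule: induct_nat_012)
  case (ge2 n)
  have "sin (real (Suc (Suc n)) * t) = 2 * cos t * sin (real (Suc n) * t) - sin (real n * t)"
  proof -
    have "sin (real (Suc (Suc n)) * t) = sin (real (Suc n) * t + t)"
      "sin (real n * t) = sin (real (Suc n) * t - t)"
      by (simp_all add: algebra_simps)
    then show ?thesis
      by (simp only: sin_add sin_diff) (simp add: algebra_simps)
  qed
  then show ?case
    using ge2 by (simp only: sin_poly.simps) (simp add: algebra_simps)
qed simp_all

lemma sin_poly_degree: "coeff (sin_poly (Suc n)) n = 1 \<and> degree (sin_poly (Suc n)) \<le> n"
proof (induction n rule: induct_nat_012)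
  case (ge2 n)
  have d: "degree ([:0, 1:] * sin_poly (Suc (Suc n))) \<le> Suc (Suc n)"
    using ge2(2) degree_pCons_le[of 0 "sin_poly (Suc (Suc n))"] by simp
  have "coeff (sin_poly (Suc n)) (Suc (Suc n)) = 0"
    using ge2(1) by (intro coeff_eq_0) simp
  moreover have "degree (sin_poly (Suc (Suc (Suc n)))) \<le> Suc (Suc n)"
    using d ge2(1) by (simp only: sin_poly.simps) (intro degree_diff_le, auto)
  ultimately show ?case using ge2(2) by simp
qed simp_all

lemma cos_root_self: "n > 0 \<Longrightarrow> cos_root n n = -2"
  by (simp add: cos_root_def)

lemma inj_on_cos_root: "inj_on (cos_root n) {0<..n}"
proof (rule inj_onI)
  fix i j assume ij: "i \<in> {0<..n}" "j \<in> {0<..n}" "cos_root n i = cos_root n j"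
  from ij(3) have "cos (pi * real i / real n) = cos (pi * real j / real n)"
    unfolding cos_root_def of_real_eq_iff by simp
  moreover have "0 \<le> pi * real k / real n \<and> pi * real k / real n \<le> pi" if "k \<in> {0<..n}" for k
    using that mult_left_mono[of "real k" "real n" pi] by (simp add: pos_divide_le_eq)
  ultimately have "pi * real i / real n = pi * real j / real n"
    using ij(1,2) cos_inj_pi by blast
  then show "i = j" using ij(1,2) by simp
qed

lemma sin_poly_cos_root:
  assumes "0 < j" "j < n"
  shows "poly (sin_poly n) (cos_root n j) = 0"
proof -
  have "sin (pi * real j / real n) > 0"
    using assms by (intro sin_gt_zero) (auto simp: field_simps)
  moreover have "sin (real n * (pi * real j / real n)) = 0"
    using assms by (simp add: mult.commute[of pi])
  ultimately show ?thesis
    using poly_sin_poly[of n "pi * real j / real n"] by (simp add: cos_root_def)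
qed

text \<open>Both sides have degree at most n, the same coefficient at n, and vanish at the n
  distinct numbers \<open>cos_root n j\<close>. The index j = n, where the sine is zero, contributes
  the root -2; the factor X + 2 accounts for it.\<close>

lemma sin_poly_factorization:
  assumes "n > 0"
  shows "[:2, 1:] * sin_poly n = (\<Prod>j\<in>{0<..n}. [:- cos_root n j, 1:])"
proof (rule poly_eqI_degree_lead_coeff[where n = n and A = "cos_root n ` {0<..n}"])
  obtain m where m: "n = Suc m" using assms by (cases n) auto
  note d = sin_poly_degree[of m, folded m]
  have deg: "degree (\<Prod>j\<in>{0<..n}. [:- cos_root n j, 1:]) = n"
    by (subst degree_prod_sum_eq) auto
  show "degree (\<Prod>j\<in>{0<..n}. [:- cos_root n j, 1:]) \<le> n"
    using deg by simp
  have "degree [:2, 1::complex:] = 1" by simp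
  then show "degree ([:2, 1:] * sin_poly n) \<le> n"
    using d m degree_mult_le[of "[:2, 1:]" "sin_poly n"] by linarith
  have "coeff (\<Prod>j\<in>{0<..n}. [:- cos_root n j, 1:]) n = 1"
    using lead_coeff_prod[of "\<lambda>j. [:- cos_root n j, 1:]" "{0<..n}"] by (simp add: deg)
  moreover have "coeff (sin_poly n) n = 0"
    using d m by (intro coeff_eq_0) simp
  then have "coeff ([:2, 1:] * sin_poly n) n = 1"
    using d m by simp
  ultimately show "coeff ([:2, 1:] * sin_poly n) n = coeff (\<Prod>j\<in>{0<..n}. [:- cos_root n j, 1:]) n"
    by simp
  show "n \<le> card (cos_root n ` {0<..n})"
    by (simp add: card_image inj_on_cos_root)
  fix z assume "z \<in> cos_root n ` {0<..n}"
  then obtain j where j: "j \<in> {0<..n}" "z = cos_root n j" by auto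
  have "poly (\<Prod>j\<in>{0<..n}. [:- cos_root n j, 1:]) z = 0"
    using j by (auto simp: poly_prod)
  moreover have "poly ([:2, 1:] * sin_poly n) z = 0"
    using j assms by (cases "j = n") (auto simp: cos_root_self sin_poly_cos_root)
  ultimately show "poly ([:2, 1:] * sin_poly n) z = poly (\<Prod>j\<in>{0<..n}. [:- cos_root n j, 1:]) z"
    by simp
qed

text \<open>A root depends only on the fraction k / n. Sorting the indices k by d = gcd k n and
  reducing the fractions turns the factorization into one block \<open>prim_poly (n div d)\<close>
  for each d.\<close>

lemma prod_prim_poly:
  assumes "n > 0"
  shows "(\<Prod>d | d dvd n. prim_poly d) = [:2, 1:] * sin_poly n"
proof -
  define A where "A d = {k\<in>{0<..n}. gcd k n = d}" for d
  have *: "(\<Prod>k\<in>A d. [:- cos_root n k, 1:]) = prim_poly (n div d)" if d: "d dvd n" for d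
  proof -
    have "d > 0" using d assms by (auto intro: Nat.gr0I)
    then have "cos_root n (k * d) = cos_root (n div d) k" for k
      using d assms by (auto simp: cos_root_def real_of_nat_div field_simps)
    then show ?thesis
      unfolding A_def prim_poly_def
      by (subst prod.reindex_bij_betw[OF bij_betw_totatives_gcd_eq[OF d assms], symmetric]) simp
  qed
  have "{0<..n} = (\<Union>d\<in>{d. d dvd n}. A d)" by (auto simp: A_def)
  then have "[:2, 1:] * sin_poly n = (\<Prod>k\<in>(\<Union>d\<in>{d. d dvd n}. A d). [:- cos_root n k, 1:])"
    using sin_poly_factorization[OF assms] by simp
  also have "\<dots> = (\<Prod>d | d dvd n. \<Prod>k\<in>A d. [:- cos_root n k, 1:])"
    using assms by (intro prod.UNION_disjoint) (auto simp: A_def)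
  also have "\<dots> = (\<Prod>d | d dvd n. prim_poly (n div d))"
    by (intro prod.cong refl *) auto
  also have "\<dots> = (\<Prod>d | d dvd n. prim_poly d)" using assms
    by (intro prod.reindex_bij_witness[of _ "(div) n" "(div) n"]) (auto elim: dvdE)
  finally show ?thesis ..
qed

lemma degree_prim_poly [simp]: "degree (prim_poly n) = totient n"
  unfolding prim_poly_def by (subst degree_prod_sum_eq) (auto simp: totient_def)

lemma lead_coeff_prim_poly: "coeff (prim_poly n) (totient n) = 1"
  using lead_coeff_prod[of "\<lambda>j. [:- cos_root n j, 1:]" "totatives n"]
  by (simp add: prim_poly_def flip: degree_prim_poly)

text \<open>Downward recursion on the index: since b is monic, the coefficient of
  \<open>b * q\<close> at \<open>degree b + i\<close> is \<open>coeff q i\<close> plus integer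
  multiples of coefficients of q of higher index.\<close>

lemma monic_quotient_Ints:
  fixes b q :: "complex poly"
  assumes "lead_coeff b = 1" "\<And>i. coeff b i \<in> \<int>" "\<And>i. coeff (b * q) i \<in> \<int>"
  shows "coeff q i \<in> \<int>"
proof (induction "degree q - i" arbitrary: i rule: less_induct)
  case less
  show ?case
  proof (cases "i > degree q")
    case True
    then show ?thesis by (simp add: coeff_eq_0)
  next
    case False
    let ?m = "degree b"
    have "coeff (b * q) (?m + i) = (\<Sum>j\<le>?m + i. coeff b j * coeff q (?m + i - j))"
      by (simp add: coeff_mult)
    also have "\<dots> = coeff b ?m * coeff q i + (\<Sum>j\<in>{..?m + i} - {?m}. coeff b j * coeff q (?m + i - j))"
      by (subst sum.remove[of _ ?m]) auto
    also have "\<dots> = coeff q i + (\<Sum>j\<in>{..?m + i} - {?m}. coeff b j * coeff q (?m + i - j))"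
      using assms(1) by simp
    finally have "coeff q i = coeff (b * q) (?m + i)
        - (\<Sum>j\<in>{..?m + i} - {?m}. coeff b j * coeff q (?m + i - j))"
      by simp
    moreover have "coeff b j * coeff q (?m + i - j) \<in> \<int>" if "j \<in> {..?m + i} - {?m}" for j
    proof (cases "j > ?m")
      case True
      then show ?thesis by (simp add: coeff_eq_0)
    next
      case jm: False
      have "coeff q (?m + i - j) \<in> \<int>"
      proof (cases "?m + i - j > degree q")
        case True
        then show ?thesis by (simp add: coeff_eq_0)
      next
        case False
        then show ?thesis using jm that \<open>\<not> i > degree q\<close> by (intro less) auto
      qed
      then show ?thesis using assms(2) by simp
    qed
    ultimately show ?thesis using assms(3) by (auto intro!: Ints_diff Ints_sum)
  qed
qed

lemma coeff_sin_poly_Ints: "coeff (sin_poly n) i \<in> \<int>"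
  by (induction n arbitrary: i rule: induct_nat_012)
    (auto simp: coeff_pCons split: nat.splits intro!: Ints_diff)

lemma coeff_prod_Ints:
  fixes f :: "'a \<Rightarrow> complex poly"
  assumes "\<And>x i. x \<in> A \<Longrightarrow> coeff (f x) i \<in> \<int>"
  shows "coeff (prod f A) i \<in> \<int>"
  using assms
proof (induction A arbitrary: i rule: infinite_finite_induct)
  case (insert x A)
  then have "coeff (prod f A) i \<in> \<int>" "coeff (f x) i \<in> \<int>" for i by auto
  then show ?case
    unfolding prod.insert[OF insert.hyps] coeff_mult by (intro Ints_sum Ints_mult)
qed auto

lemma coeff_prim_poly_Ints: "n > 0 \<Longrightarrow> coeff (prim_poly n) i \<in> \<int>"
proof (induction n arbitrary: i rule: less_induct)
  case (less n)
  let ?r = "\<Prod>d\<in>{d. d dvd n} - {n}. prim_poly d"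
  have fin: "finite {d. d dvd n}" using less.prems by simp
  have eq: "?r * prim_poly n = [:2, 1:] * sin_poly n"
    using less.prems prod.remove[OF fin, of n prim_poly] prod_prim_poly[of n] by (simp add: mult.commute)
  have "coeff ([:2, 1:] * sin_poly n) i \<in> \<int>" for i
    by (auto simp: coeff_pCons split: nat.splits intro!: Ints_add Ints_mult coeff_sin_poly_Ints)
  then have "coeff (?r * prim_poly n) i \<in> \<int>" for i
    by (simp only: eq)
  moreover have "lead_coeff ?r = 1"
    using lead_coeff_prim_poly by (simp add: lead_coeff_prod)
  moreover have "coeff ?r i \<in> \<int>" for i
  proof (rule coeff_prod_Ints)
    fix d i assume "d \<in> {d. d dvd n} - {n}"
    then show "coeff (prim_poly d) i \<in> \<int>"
      using less.prems by (intro less.IH) (auto intro: Nat.gr0I dest: dvd_imp_le)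
  qed
  ultimately show ?case by (rule monic_quotient_Ints[rotated 2])
qed

text \<open>Replacing j by n - j permutes the totatives and negates the roots. For n = 1 the only
  root is -2, which has no partner.\<close>

lemma prim_poly_reflect:
  assumes "n > 1"
  shows "pcompose (prim_poly n) [:0, -1:] = smult ((-1) ^ totient n) (prim_poly n)"
proof -
  have root: "cos_root n (n - j) = - cos_root n j" if "j \<in> totatives n" for j
  proof -
    have "j \<le> n" using that by (simp add: totatives_le)
    then have "pi * real (n - j) / real n = pi - pi * real j / real n"
      using assms by (simp add: of_nat_diff field_simps)
    then show ?thesis by (simp add: cos_root_def)
  qed
  have "pcompose (prim_poly n) [:0, -1:] = (\<Prod>j\<in>totatives n. [:- cos_root n j, -1:])"
    by (simp add: prim_poly_def pcompose_prod pcompose_pCons)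
  also have "\<dots> = (\<Prod>j\<in>totatives n. [:- cos_root n (n - j), -1:])"
  proof (rule prod.reindex_bij_witness[of _ "\<lambda>j. n - j" "\<lambda>j. n - j"])
    fix j assume j: "j \<in> totatives n"
    then have "j < n" using assms by (simp add: totatives_less)
    then show "n - (n - j) = j" "n - (n - j) = j" by auto
    have "gcd (n - j) n = gcd j n"
      using \<open>j < n\<close> by (intro gcd_diff2_nat) simp
    then show "n - j \<in> totatives n" "n - j \<in> totatives n"
      using j \<open>j < n\<close> unfolding in_totatives_iff coprime_iff_gcd_eq_1 by simp_all
    show "[:- cos_root n (n - (n - j)), - 1:] = [:- cos_root n j, - 1:]"
      using \<open>j < n\<close> by simp
  qed
  also have "\<dots> = (\<Prod>j\<in>totatives n. [:-1:] * [:- cos_root n j, 1:])"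
    by (rule prod.cong) (auto simp: root)
  also have "\<dots> = [:-1:] ^ totient n * prim_poly n"
    unfolding prod.distrib prim_poly_def totient_def by simp
  also have "\<dots> = smult ((-1) ^ totient n) (prim_poly n)"
    by (simp add: poly_const_pow)
  finally show ?thesis .
qed

lemma coeff_prim_poly_parity:
  assumes "n > 1" "odd (totient n + i)"
  shows "coeff (prim_poly n) i = 0"
proof -
  have "(-1) ^ i * coeff (prim_poly n) i = (-1) ^ totient n * coeff (prim_poly n) i"
    using arg_cong[OF prim_poly_reflect[OF assms(1)], of "\<lambda>p. coeff p i"]
    by (simp add: coeff_pcompose_linear)
  then show ?thesis using assms(2) by (cases "even i") auto
qed

text \<open>
  By parity only the coefficients of index \<open>totient n - 2 * j\<close> survive, so that the homogenization
  of \<open>prim_poly n\<close> is a polynomial in \<open>P\<close> and \<open>Q\<close>, without a square root of \<open>Q\<close>.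
\<close>

definition dual_coeff :: "nat \<Rightarrow> nat \<Rightarrow> int" where
  "dual_coeff n j = (SOME c. of_int c = coeff (prim_poly n) (totient n - 2 * j))"

definition dualU :: "int \<Rightarrow> int \<Rightarrow> nat \<Rightarrow> int" where
  "dualU P Q n = (if n = 1 then 1
     else \<Sum>j\<le>totient n div 2. dual_coeff n j * P ^ (totient n - 2 * j) * Q ^ j)"

lemma dualU_1 [simp]: "dualU P Q (Suc 0) = 1"
  by (simp add: dualU_def)

lemma of_int_dual_coeff:
  "n > 0 \<Longrightarrow> of_int (dual_coeff n j) = coeff (prim_poly n) (totient n - 2 * j)"
  unfolding dual_coeff_def
  by (rule someI_ex) (use coeff_prim_poly_Ints in \<open>metis Ints_cases\<close>)

lemma of_int_dualU:
  assumes n: "n > 1" and s: "s\<^sup>2 = of_int Q" "s \<noteq> 0"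
  shows "of_int (dualU P Q n) = s ^ totient n * poly (prim_poly n) (of_int P / s)"
proof -
  let ?t = "totient n" and ?f = "\<lambda>i. coeff (prim_poly n) i * of_int P ^ i * s ^ (totient n - i)"
  have "s ^ ?t * poly (prim_poly n) (of_int P / s) = (\<Sum>i\<le>?t. ?f i)"
    using s by (auto simp: poly_altdef sum_distrib_left power_divide power_diff intro!: sum.cong)
  also have "\<dots> = (\<Sum>i\<in>(\<lambda>j. ?t - 2 * j) ` {..?t div 2}. ?f i)"
  proof (rule sum.mono_neutral_right)
    show "\<forall>i\<in>{..?t} - (\<lambda>j. ?t - 2 * j) ` {..?t div 2}. ?f i = 0"
    proof
      fix i assume i: "i \<in> {..?t} - (\<lambda>j. ?t - 2 * j) ` {..?t div 2}"
      have "odd (?t + i)"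
      proof
        assume "even (?t + i)"
        then have "even (?t - i)" by simp
        then obtain j where "?t - i = 2 * j" by (elim evenE)
        then have "i = ?t - 2 * j" "j \<le> ?t div 2" using i by auto
        then show False using i by auto
      qed
      then show "?f i = 0" using coeff_prim_poly_parity[OF n] by simp
    qed
  qed auto
  also have "\<dots> = (\<Sum>j\<le>?t div 2. ?f (?t - 2 * j))"
    by (subst sum.reindex) (auto simp: inj_on_def)
  also have "\<dots> = of_int (dualU P Q n)"
    using n unfolding dualU_def of_int_sum
    by (auto simp: of_int_dual_coeff power_mult s intro!: sum.cong)
  finally show ?thesis by simp
qed

lemma of_int_lucU_sin_poly:
  assumes "s\<^sup>2 = of_int Q" "s \<noteq> 0"
  shows "s * of_int (lucU P Q n) = s ^ n * poly (sin_poly n) (of_int P / s)"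
proof (induction n rule: induct_nat_012)
  case (ge2 n)
  have "s * of_int (lucU P Q (Suc (Suc n)))
      = of_int P * (s * of_int (lucU P Q (Suc n))) - s\<^sup>2 * (s * of_int (lucU P Q n))"
    by (simp add: assms(1) algebra_simps)
  also have "\<dots> = s ^ Suc (Suc n) * poly (sin_poly (Suc (Suc n))) (of_int P / s)"
    unfolding ge2 using assms(2) by (simp add: field_simps power2_eq_square)
  finally show ?case .
qed simp_all

theorem prod_dualU:
  assumes n: "n > 0" and "Q \<noteq> 0" and D: "lucas_D P Q \<noteq> 0"
  shows "(\<Prod>d | d dvd n. dualU P Q d) = lucU P Q n"
proof -
  define s where "s = csqrt (of_int Q)"
  have s: "s\<^sup>2 = of_int Q" "s \<noteq> 0" using assms by (auto simp: s_def)
  have nz: "of_int P + 2 * s \<noteq> 0"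
  proof
    assume "of_int P + 2 * s = 0"
    then have "(of_int P)\<^sup>2 = 4 * s\<^sup>2"
      by (metis add_eq_0_iff power2_minus power_mult_distrib power2_eq_square
          mult_2 numeral_Bit0 four_x_squared)
    then have "(of_int (P\<^sup>2) :: complex) = of_int (4 * Q)" using s by simp
    then show False using D unfolding of_int_eq_iff lucas_D_def by simp
  qed
  have fin: "finite {d. d dvd n}" using n by simp
  let ?S = "{d. d dvd n} - {1}"
  let ?x = "of_int P / s"
  \<comment> \<open>The divisor 1 is left out, so the weights add up to n - 1, the weight of U_n;
    the missing power of s is the one multiplying \<open>lucU\<close> in
    \<open>of_int_lucU_sin_poly\<close>.\<close>
  have t: "(\<Sum>d\<in>?S. totient d) + 1 = n"
    using totient_divisor_sum[of n] sum.remove[OF fin, of 1 totient] by simp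
  have "prim_poly 1 = [:2, 1:]" by (simp add: prim_poly_def cos_root_def)
  then have "(\<Prod>d | d dvd n. prim_poly d) = [:2, 1:] * (\<Prod>d\<in>?S. prim_poly d)"
    using prod.remove[OF fin, of 1 prim_poly] by simp
  then have "[:2, 1:] * (\<Prod>d\<in>?S. prim_poly d) = [:2, 1:] * sin_poly n"
    using prod_prim_poly[OF n] by simp
  then have pp: "(\<Prod>d\<in>?S. prim_poly d) = sin_poly n"
    by (subst (asm) mult_cancel_left) auto
  have "of_int (\<Prod>d | d dvd n. dualU P Q d) = (\<Prod>d\<in>?S. of_int (dualU P Q d) :: complex)"
    using prod.remove[OF fin, of 1 "dualU P Q"] by simp
  also have "\<dots> = (\<Prod>d\<in>?S. s ^ totient d * poly (prim_poly d) ?x)"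
  proof (rule prod.cong[OF refl])
    fix d assume "d \<in> ?S"
    then have "d > 1" using n by (cases d) auto
    then show "of_int (dualU P Q d) = s ^ totient d * poly (prim_poly d) ?x"
      by (rule of_int_dualU[OF _ s])
  qed
  also have "\<dots> = s ^ (\<Sum>d\<in>?S. totient d) * poly (sin_poly n) ?x"
    by (simp add: prod.distrib power_sum pp[symmetric] poly_prod)
  also have "\<dots> = of_int (lucU P Q n)"
  proof -
    have "s * (s ^ (\<Sum>d\<in>?S. totient d) * poly (sin_poly n) ?x)
        = s ^ ((\<Sum>d\<in>?S. totient d) + 1) * poly (sin_poly n) ?x"
      by simp
    also have "\<dots> = s * of_int (lucU P Q n)"
      unfolding t by (rule of_int_lucU_sin_poly[OF s, symmetric])
    finally show ?thesis using s by simp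
  qed
  finally show ?thesis by (simp only: of_int_eq_iff)
qed

section \<open>Multiplicative Moebius inversion\<close>

lemma moebius_mu_prime_mult:
  assumes "prime q" "\<not> q dvd d" "squarefree d"
  shows "moebius_mu (q * d) = - moebius_mu d"
proof -
  have "d \<noteq> 0" using assms(3) by (intro notI) simp
  have "squarefree (q * d)"
    using assms squarefree_mult_coprime[of q d] prime_imp_coprime[of q d] squarefree_prime[of q]
    by blast
  moreover have "prime_factors (q * d) = insert q (prime_factors d)"
    using \<open>d \<noteq> 0\<close> assms(1) by (simp add: prime_factors_product prime_factorization_prime)
  moreover have "q \<notin> prime_factors d" using assms(2) by auto
  ultimately show ?thesis using assms(3) by (simp add: moebius_mu_def)
qed

text \<open>For a prime q dividing n, multiplication by q pairs the squarefree divisors prime to q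
  with those divisible by q, and changes the sign.\<close>

lemma sum_moebius_mu:
  assumes "n > 0"
  shows "(\<Sum>d | d dvd n. moebius_mu d) = (if n = 1 then 1 else 0)"
proof (cases "n = 1")
  case True
  then show ?thesis by (simp add: moebius_mu_def)
next
  case False
  then obtain q where q: "prime q" "q dvd n" using prime_factor_nat by blast
  define A where "A = {d. d dvd n \<and> squarefree d \<and> \<not> q dvd d}"
  have fin: "finite {d. d dvd n}" using assms by simp
  then have finA: "finite A" by (rule rev_finite_subset) (auto simp: A_def)
  have B: "{d. d dvd n \<and> squarefree d \<and> q dvd d} = (*) q ` A"
  proof (intro equalityI subsetI)
    fix d assume d: "d \<in> {d. d dvd n \<and> squarefree d \<and> q dvd d}"
    then obtain e where e: "d = q * e" by auto
    have "\<not> q dvd e"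
    proof
      assume "q dvd e"
      then have "q\<^sup>2 dvd d" using e by (auto simp: power2_eq_square)
      then show False using d q(1) by (auto simp: squarefree_def)
    qed
    then show "d \<in> (*) q ` A"
      using d e unfolding A_def by (auto dest: dvd_mult_right intro: squarefree_multD)
  next
    fix d assume "d \<in> (*) q ` A"
    then obtain e where e: "d = q * e" "e dvd n" "squarefree e" "\<not> q dvd e"
      by (auto simp: A_def)
    have "coprime q e" using e q by (auto intro: prime_imp_coprime)
    then show "d \<in> {d. d dvd n \<and> squarefree d \<and> q dvd d}"
      using e q by (simp add: divides_mult squarefree_mult_coprime squarefree_prime)
  qed
  have "(\<Sum>d | d dvd n. moebius_mu d) = (\<Sum>d\<in>A \<union> (*) q ` A. moebius_mu d)"
    unfolding B[symmetric] using fin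
    by (intro sum.mono_neutral_right) (auto simp: A_def moebius_mu_def)
  also have "\<dots> = (\<Sum>d\<in>A. moebius_mu d) + (\<Sum>d\<in>(*) q ` A. moebius_mu d)"
    using finA by (intro sum.union_disjoint) (auto simp: A_def)
  also have "(\<Sum>d\<in>(*) q ` A. moebius_mu d) = (\<Sum>d\<in>A. moebius_mu (q * d))"
    using q(1) by (subst sum.reindex) (auto simp: inj_on_def)
  also have "\<dots> = (\<Sum>d\<in>A. - moebius_mu d)"
    using q(1) by (intro sum.cong refl moebius_mu_prime_mult) (auto simp: A_def)
  finally show ?thesis using False by (simp add: sum_negf)
qed

lemma prod_power_int:
  fixes x :: "'a :: field"
  assumes "x \<noteq> 0"
  shows "(\<Prod>i\<in>A. x powi f i) = x powi (\<Sum>i\<in>A. f i)"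
  by (induction A rule: infinite_finite_induct) (simp_all add: power_int_add assms)

lemma power_int_prod_distrib:
  fixes f :: "'b \<Rightarrow> 'a :: field"
  shows "(\<Prod>i\<in>A. f i) powi k = (\<Prod>i\<in>A. f i powi k)"
  by (induction A rule: infinite_finite_induct) (simp_all add: power_int_mult_distrib)

text \<open>After the two products are exchanged, \<open>f e\<close> carries as exponent the sum of
  mu over the divisors of \<open>n div e\<close>, which is 0 unless e = n. Adding exponents that may
  be negative requires \<open>f e\<close> to be nonzero.\<close>

lemma moebius_inversion_prod:
  fixes f g :: "nat \<Rightarrow> 'a :: field"
  assumes n: "n > 0" and g: "\<And>d. d dvd n \<Longrightarrow> g d = (\<Prod>e | e dvd d. f e)"
    and nz: "\<And>d. d dvd n \<Longrightarrow> f d \<noteq> 0"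
  shows "(\<Prod>d | d dvd n. g d powi moebius_mu (n div d)) = f n"
proof -
  let ?S = "{d. d dvd n}"
  have fin: "finite ?S" using n by simp
  have "(\<Prod>d\<in>?S. g d powi moebius_mu (n div d))
      = (\<Prod>d\<in>?S. \<Prod>e | e \<in> ?S \<and> e dvd d. f e powi moebius_mu (n div d))"
  proof (rule prod.cong[OF refl])
    fix d assume d: "d \<in> ?S"
    then have "{e. e dvd d} = {e. e \<in> ?S \<and> e dvd d}" by (auto intro: dvd_trans)
    then show "g d powi moebius_mu (n div d) =
        (\<Prod>e | e \<in> ?S \<and> e dvd d. f e powi moebius_mu (n div d))"
      using d g[of d] by (simp add: power_int_prod_distrib)
  qed
  also have "\<dots> = (\<Prod>e\<in>?S. \<Prod>d | d \<in> ?S \<and> e dvd d. f e powi moebius_mu (n div d))"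
    by (rule prod.swap_restrict[OF fin fin])
  also have "\<dots> = (\<Prod>e\<in>?S. if e = n then f e else 1)"
  proof (rule prod.cong[OF refl])
    fix e assume e: "e \<in> ?S"
    then have e0: "e > 0" using n by (auto intro: Nat.gr0I)
    have "(\<Sum>d | d \<in> ?S \<and> e dvd d. moebius_mu (n div d)) = (\<Sum>c | c dvd n div e. moebius_mu c)"
    proof (rule sum.reindex_bij_witness[of _ "\<lambda>c. n div c" "\<lambda>d. n div d"])
      fix d assume d: "d \<in> {d. d \<in> ?S \<and> e dvd d}"
      then obtain a b where ab: "n = d * a" "d = e * b" by (auto elim!: dvdE)
      then show "n div (n div d) = d" "n div d \<in> {c. c dvd n div e}"
        using n by auto
    next
      fix c assume c: "c \<in> {c. c dvd n div e}"
      then obtain a where a: "n div e = c * a" by (auto elim!: dvdE)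
      then have "n = e * (c * a)" using e by (metis dvd_mult_div_cancel mem_Collect_eq)
      then show "n div (n div c) = c" "n div c \<in> {d. d \<in> ?S \<and> e dvd d}"
        using n by auto
    qed simp
    moreover have "n div e > 0" "n div e = 1 \<longleftrightarrow> e = n"
      using n e e0 by (auto elim!: dvdE simp: div_greater_zero_iff dvd_imp_le)
    ultimately show "(\<Prod>d | d \<in> ?S \<and> e dvd d. f e powi moebius_mu (n div d)) = (if e = n then f e else 1)"
      using nz[of e] e by (simp add: prod_power_int sum_moebius_mu)
  qed
  also have "\<dots> = f n" using fin by (simp add: prod.delta)
  finally show ?thesis .
qed

lemma lucU_nonzero:
  assumes "lucas_D P Q \<noteq> 0" "nondegenerate_U P Q" "n > 0"
  shows "lucU P Q n \<noteq> 0"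
  using assms of_int_lucU[OF assms(1), of n] by (force simp: nondegenerate_U_def)

lemma dualU_dvd_lucU:
  assumes "n > 0" "Q \<noteq> 0" "lucas_D P Q \<noteq> 0" "d dvd n"
  shows "dualU P Q d dvd lucU P Q n"
  unfolding prod_dualU[OF assms(1-3), symmetric] using assms(1,4) by (intro dvd_prodI) auto

text \<open>Nondegeneracy enters here: each \<open>dualU P Q d\<close> divides a nonzero Lucas
  number, so it is nonzero and the inversion over the complex numbers applies.\<close>

theorem moebius_dual_U_eq_dualU:
  assumes "Q \<noteq> 0" "lucas_D P Q \<noteq> 0" "nondegenerate_U P Q" "n > 0"
  shows "moebius_dual_U P Q n = of_int (dualU P Q n)"
  unfolding moebius_dual_U_def
proof (rule moebius_inversion_prod[OF assms(4)])
  fix d assume "d dvd n"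
  then have d: "d > 0" using assms(4) by (auto intro: Nat.gr0I)
  show "lucas_U P Q d = (\<Prod>e | e dvd d. of_int (dualU P Q e))"
    using prod_dualU[OF d assms(1,2)] of_int_lucU[OF assms(2), of d] by (simp flip: of_int_prod)
  show "of_int (dualU P Q d) \<noteq> (0 :: complex)"
    using dualU_dvd_lucU[OF d assms(1,2), of d] lucU_nonzero[OF assms(2,3) d] by auto
qed

section \<open>Identities and congruences for Lucas sequences\<close>

fun lucV :: "int \<Rightarrow> int \<Rightarrow> nat \<Rightarrow> int" where
  "lucV P Q 0 = 2"
| "lucV P Q (Suc 0) = P"
| "lucV P Q (Suc (Suc n)) = P * lucV P Q (Suc n) - Q * lucV P Q n"

lemma lucV_2: "lucV P Q 2 = P\<^sup>2 - 2 * Q"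
  by (simp add: numeral_2_eq_2 power2_eq_square)

lemma lucU_2: "lucU P Q 2 = P"
  by (simp add: numeral_2_eq_2)

lemma lucas_roots:
  obtains x y :: complex where "x + y = of_int P" "x * y = of_int Q" "(x - y)\<^sup>2 = of_int (lucas_D P Q)"
proof
  let ?x = "lucas_alpha P Q" and ?y = "lucas_beta P Q"
  show s: "?x + ?y = of_int P"
    by (simp add: lucas_alpha_def lucas_beta_def field_simps)
  have "?x - ?y = csqrt (of_int (lucas_D P Q))"
    by (simp add: lucas_alpha_def lucas_beta_def field_simps)
  then show d: "(?x - ?y)\<^sup>2 = of_int (lucas_D P Q)" by simp
  have "4 * (?x * ?y) = (?x + ?y)\<^sup>2 - (?x - ?y)\<^sup>2"
    by (simp add: power2_eq_square algebra_simps)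
  also have "\<dots> = 4 * of_int Q"
    unfolding s d by (simp add: lucas_D_def)
  finally show "?x * ?y = of_int Q" by simp
qed

lemma
  fixes x y :: complex
  assumes "x + y = of_int P" "x * y = of_int Q"
  shows lucV_roots: "of_int (lucV P Q n) = x ^ n + y ^ n"
    and lucU_roots: "(x - y) * of_int (lucU P Q n) = x ^ n - y ^ n"
proof -
  show "of_int (lucV P Q n) = x ^ n + y ^ n"
    by (induction n rule: induct_nat_012)
      (simp_all add: assms[symmetric] algebra_simps)
  show "(x - y) * of_int (lucU P Q n) = x ^ n - y ^ n"
  proof (induction n rule: induct_nat_012)
    case (ge2 n)
    have "(x - y) * of_int (lucU P Q (Suc (Suc n)))
        = of_int P * ((x - y) * of_int (lucU P Q (Suc n))) - of_int Q * ((x - y) * of_int (lucU P Q n))"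
      by (simp add: algebra_simps)
    also have "\<dots> = x ^ Suc (Suc n) - y ^ Suc (Suc n)"
      unfolding ge2 assms[symmetric] by (simp add: algebra_simps)
    finally show ?case .
  qed simp_all
qed

text \<open>x^m and y^m have sum V_m and product Q^m, so taking every m-th term amounts to a change
  of parameters; the recursions in powers of p rest on this.\<close>

lemma lucV_mult: "lucV (lucV P Q m) (Q ^ m) n = lucV P Q (m * n)"
proof -
  obtain x y :: complex where xy: "x + y = of_int P" "x * y = of_int Q" by (rule lucas_roots)
  have "x ^ m + y ^ m = of_int (lucV P Q m)" "x ^ m * y ^ m = of_int (Q ^ m)"
    by (simp_all add: lucV_roots[OF xy] xy(2) flip: power_mult_distrib)
  from lucV_roots[OF this, of n] lucV_roots[OF xy, of "m * n"]
  show ?thesis by (simp add: power_mult flip: of_int_eq_iff[where ?'a = complex])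
qed

lemma lucU_mult:
  assumes "lucas_D P Q \<noteq> 0"
  shows "lucU P Q m * lucU (lucV P Q m) (Q ^ m) n = lucU P Q (m * n)"
proof -
  obtain x y :: complex where xy: "x + y = of_int P" "x * y = of_int Q"
    and d: "(x - y)\<^sup>2 = of_int (lucas_D P Q)" by (rule lucas_roots)
  have "x ^ m + y ^ m = of_int (lucV P Q m)" "x ^ m * y ^ m = of_int (Q ^ m)"
    by (simp_all add: lucV_roots[OF xy] xy(2) flip: power_mult_distrib)
  from lucU_roots[OF this, of n]
  have "(x - y) * of_int (lucU P Q m * lucU (lucV P Q m) (Q ^ m) n)
      = (x - y) * of_int (lucU P Q (m * n))"
    unfolding lucU_roots[OF xy] of_int_mult mult.assoc[symmetric] by (simp add: power_mult)
  moreover have "x - y \<noteq> 0" using d assms by auto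
  ultimately show ?thesis by (simp only: mult_cancel_left of_int_eq_iff) simp
qed

text \<open>The new discriminant is (x^m - y^m)^2. Consequently p dividing U_m makes p^2 divide it,
  which brings the entry point under the ramified case.\<close>

lemma lucas_D_lucV: "lucas_D (lucV P Q m) (Q ^ m) = lucas_D P Q * (lucU P Q m)\<^sup>2"
proof -
  obtain x y :: complex where xy: "x + y = of_int P" "x * y = of_int Q"
    and d: "(x - y)\<^sup>2 = of_int (lucas_D P Q)" by (rule lucas_roots)
  have "of_int (lucas_D (lucV P Q m) (Q ^ m)) = (x ^ m + y ^ m)\<^sup>2 - 4 * (x * y) ^ m"
    by (simp add: lucas_D_def lucV_roots[OF xy] xy(2))
  also have "\<dots> = (x ^ m - y ^ m)\<^sup>2"
    by (simp add: power2_eq_square power_mult_distrib algebra_simps)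
  also have "\<dots> = of_int (lucas_D P Q * (lucU P Q m)\<^sup>2)"
    by (simp add: d[symmetric] lucU_roots[OF xy, symmetric] power_mult_distrib)
  finally show ?thesis by (simp only: of_int_eq_iff)
qed

lemma lucV_double: "lucV P Q (2 * m) = (lucV P Q m)\<^sup>2 - 2 * Q ^ m"
  using lucV_mult[of P Q m 2] by (simp add: lucV_2 mult.commute)

lemma lucU_add: "lucU P Q (Suc (m + n)) = lucU P Q (Suc m) * lucU P Q (Suc n) - Q * lucU P Q m * lucU P Q n"
proof (induction n rule: induct_nat_012)
  case (ge2 n)
  have "lucU P Q (Suc (m + Suc (Suc n))) = P * lucU P Q (Suc (m + Suc n)) - Q * lucU P Q (Suc (m + n))"
    by simp
  also have "\<dots> = lucU P Q (Suc m) * lucU P Q (Suc (Suc (Suc n))) - Q * lucU P Q m * lucU P Q (Suc (Suc n))"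
    unfolding ge2 by (simp add: algebra_simps)
  finally show ?case .
qed simp_all

section \<open>Congruences in the parameters and at prime indices\<close>

lemma lucV_cong:
  assumes "[P = P'] (mod m)" "[Q = Q'] (mod m)"
  shows "[lucV P Q n = lucV P' Q' n] (mod m)"
  by (induction n rule: induct_nat_012) (simp_all add: assms cong_diff cong_mult)

lemma lucU_cong:
  assumes "[P = P'] (mod m)" "[Q = Q'] (mod m)"
  shows "[lucU P Q n = lucU P' Q' n] (mod m)"
  by (induction n rule: induct_nat_012) (simp_all add: assms cong_diff cong_mult)

lemma dualU_cong:
  assumes "[P = P'] (mod m)" "[Q = Q'] (mod m)"
  shows "[dualU P Q n = dualU P' Q' n] (mod m)"
  unfolding dualU_def by (auto intro!: cong_sum cong_mult cong_pow assms)

text \<open>The terms of index i and 2 h + 1 - i are combined; an odd exponent leaves no middle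
  term. Each pair is symmetric in x and y, so it becomes a Lucas number when x and y are the
  roots.\<close>

lemma binomial_odd_paired:
  fixes x y :: "'a :: comm_ring_1"
  shows "(x + y) ^ (2 * h + 1) = (\<Sum>i\<le>h. of_nat ((2 * h + 1) choose i) * (x * y) ^ i *
    (x ^ (2 * h + 1 - 2 * i) + y ^ (2 * h + 1 - 2 * i)))"
proof -
  let ?p = "2 * h + 1"
  let ?f = "\<lambda>i. of_nat (?p choose i) * x ^ i * y ^ (?p - i)"
  have "(x + y) ^ ?p = (\<Sum>i\<le>?p. ?f i)" by (rule binomial_ring)
  also have "{..?p} = {..h} \<union> {h<..?p}" by auto
  also have "(\<Sum>i\<in>\<dots>. ?f i) = (\<Sum>i\<le>h. ?f i) + (\<Sum>i\<in>{h<..?p}. ?f i)"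
    by (rule sum.union_disjoint) auto
  also have "(\<Sum>i\<in>{h<..?p}. ?f i) = (\<Sum>i\<le>h. ?f (?p - i))"
    by (rule sum.reindex_bij_witness[of _ "\<lambda>i. ?p - i" "\<lambda>i. ?p - i"]) auto
  also have "(\<Sum>i\<le>h. ?f i) + \<dots>
      = (\<Sum>i\<le>h. of_nat (?p choose i) * (x * y) ^ i * (x ^ (?p - 2 * i) + y ^ (?p - 2 * i)))"
    unfolding sum.distrib[symmetric]
  proof (rule sum.cong[OF refl])
    fix i assume "i \<in> {..h}"
    then have i: "i \<le> h" by simp
    then obtain r where r: "?p - 2 * i = r" "?p - i = r + i" "?p - (?p - i) = i" by auto
    have "?p choose (?p - i) = ?p choose i" using i by (intro binomial_symmetric[symmetric]) simp
    then show "?f i + ?f (?p - i) = of_nat (?p choose i) * (x * y) ^ i * (x ^ (?p - 2 * i) + y ^ (?p - 2 * i))"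
      using r by (simp add: power_add power_mult_distrib algebra_simps)
  qed
  finally show ?thesis .
qed

lemma lucV_binomial:
  "P ^ (2 * h + 1) = (\<Sum>i\<le>h. of_nat ((2 * h + 1) choose i) * Q ^ i * lucV P Q (2 * h + 1 - 2 * i))"
proof -
  obtain x y :: complex where xy: "x + y = of_int P" "x * y = of_int Q" by (rule lucas_roots)
  have "(of_int (P ^ (2 * h + 1)) :: complex) = (x + y) ^ (2 * h + 1)"
    by (simp only: of_int_power xy)
  also have "\<dots> = of_int (\<Sum>i\<le>h. of_nat ((2 * h + 1) choose i) * Q ^ i * lucV P Q (2 * h + 1 - 2 * i))"
    unfolding binomial_odd_paired
    by (simp only: of_int_sum of_int_mult of_int_power of_int_of_nat_eq xy lucV_roots[OF xy])
  finally show ?thesis by (simp only: of_int_eq_iff)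
qed

text \<open>The paired expansion of (x - y)^(2 h + 1): with y replaced by -y the product is -Q and
  sums of odd powers become differences. Cancelling x - y leaves D^h.\<close>

lemma lucU_binomial:
  assumes "lucas_D P Q \<noteq> 0"
  shows "lucas_D P Q ^ h = (\<Sum>i\<le>h. of_nat ((2 * h + 1) choose i) * (- Q) ^ i * lucU P Q (2 * h + 1 - 2 * i))"
proof -
  obtain x y :: complex where xy: "x + y = of_int P" "x * y = of_int Q"
    and d: "(x - y)\<^sup>2 = of_int (lucas_D P Q)" by (rule lucas_roots)
  let ?p = "2 * h + 1"
  have "(x - y) * of_int (lucas_D P Q ^ h) = (x - y) ^ ?p"
    by (simp add: d[symmetric] power_mult)
  also have "\<dots> = (\<Sum>i\<le>h. of_nat (?p choose i) * (- (x * y)) ^ i * (x ^ (?p - 2 * i) + (- y) ^ (?p - 2 * i)))"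
    using binomial_odd_paired[of x "- y" h] by simp
  also have "\<dots> = (\<Sum>i\<le>h. (x - y) * of_int (of_nat (?p choose i) * (- Q) ^ i * lucU P Q (?p - 2 * i)))"
  proof (rule sum.cong[OF refl])
    fix i assume "i \<in> {..h}"
    then have "odd (?p - 2 * i)" by simp
    then have "x ^ (?p - 2 * i) + (- y) ^ (?p - 2 * i) = (x - y) * of_int (lucU P Q (?p - 2 * i))"
      unfolding lucU_roots[OF xy] by simp
    then show "of_nat (?p choose i) * (- (x * y)) ^ i * (x ^ (?p - 2 * i) + (- y) ^ (?p - 2 * i))
        = (x - y) * of_int (of_nat (?p choose i) * (- Q) ^ i * lucU P Q (?p - 2 * i))"
      using xy(2) by simp
  qed
  also have "\<dots> = (x - y) * of_int (\<Sum>i\<le>h. of_nat (?p choose i) * (- Q) ^ i * lucU P Q (?p - 2 * i))"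
    by (simp only: of_int_sum sum_distrib_left)
  finally have "(x - y) * of_int (lucas_D P Q ^ h) = \<dots>" .
  moreover have "x - y \<noteq> 0" using d assms by auto
  ultimately show ?thesis by (simp only: mult_cancel_left of_int_eq_iff) simp
qed

text \<open>a^p - b^p is (a - b) times a sum of p terms, each congruent to b^(p - 1) modulo p, so
  the second factor supplies one further p.\<close>

lemma cong_power_prime_lift:
  fixes a b :: int
  assumes "k \<ge> 1" "[a = b] (mod int p ^ k)"
  shows "[a ^ p = b ^ p] (mod int p ^ (k + 1))"
proof -
  have "int p dvd int p ^ k" using assms(1) by (intro dvd_power) simp
  then have ab: "[a = b] (mod int p)" using assms(2) cong_dvd_modulus by blast
  have "[(\<Sum>i<p. b ^ (p - Suc i) * a ^ i) = (\<Sum>i<p. b ^ (p - Suc i) * b ^ i)] (mod int p)"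
    by (intro cong_sum cong_mult cong_pow ab) simp
  also have "(\<Sum>i<p. b ^ (p - Suc i) * b ^ i) = (\<Sum>i<p. b ^ (p - 1))"
    by (intro sum.cong refl) (simp flip: power_add)
  also have "\<dots> = int p * b ^ (p - 1)" by simp
  finally have "int p dvd (\<Sum>i<p. b ^ (p - Suc i) * a ^ i)"
    using cong_dvd_iff by fastforce
  moreover have "int p ^ k dvd a - b" using assms(2) by (simp add: cong_iff_dvd_diff)
  ultimately have "int p ^ k * int p dvd a ^ p - b ^ p"
    unfolding power_diff_sumr2 by (rule mult_dvd_mono[rotated])
  then show ?thesis by (simp add: cong_iff_dvd_diff mult.commute)
qed

lemma fermat_int:
  fixes a :: int
  assumes "prime p"
  shows "[a ^ p = a] (mod int p)"
proof (cases "int p dvd a")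
  case True
  moreover have "a dvd a ^ p - a"
    using prime_gt_0_nat[OF assms] by (simp add: dvd_diff dvd_power)
  ultimately show ?thesis unfolding cong_iff_dvd_diff by (rule dvd_trans)
next
  case False
  have "residues (int p)" using prime_gt_1_nat[OF assms] by (simp add: residues_def)
  moreover have "coprime a (int p)"
    using False assms by (metis coprime_commute prime_imp_coprime prime_nat_int_transfer)
  ultimately have "[a ^ (p - 1) = 1] (mod int p)"
    using residues.euler_theorem[of "int p" a] assms by (simp add: totient_prime)
  then have "[a ^ (p - 1) * a = 1 * a] (mod int p)" by (intro cong_mult) auto
  then show ?thesis using prime_gt_0_nat[OF assms] by (simp flip: power_Suc2)
qed

lemma power_prime_power_cong:
  fixes a :: int
  assumes "prime p"
  shows "[a ^ (p ^ Suc k) = a ^ (p ^ k)] (mod int p ^ Suc k)"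
proof (induction k)
  case 0
  then show ?case using fermat_int[OF assms, of a] by simp
next
  case (Suc k)
  from cong_power_prime_lift[OF _ this]
  show ?case by (simp add: mult.commute flip: power_mult)
qed

text \<open>In the expansion of P^p the inner binomial coefficients are divisible by p, so for those
  terms congruence modulo p^k suffices; P^p itself gains a power as any p-th power does. The pairing
  needs an odd exponent, hence the separate case V_2 = P^2 - 2 Q.\<close>

lemma lucV_prime_lift:
  assumes p: "prime p" and k: "k \<ge> 1"
    and c: "[P = P'] (mod int p ^ k)" "[Q = Q'] (mod int p ^ k)"
  shows "[lucV P Q p = lucV P' Q' p] (mod int p ^ (k + 1))"
proof -
  have scale: "[int p * a = int p * b] (mod int p ^ (k + 1))" if "[a = b] (mod int p ^ k)" for a b
    using that by (auto simp: cong_iff_dvd_diff simp flip: right_diff_distrib)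
  note lift = cong_power_prime_lift[OF k c(1)]
  show ?thesis
  proof (cases "p = 2")
    case True
    then show ?thesis
      using cong_diff[OF lift scale[OF c(2)]] by (simp add: lucV_2)
  next
    case False
    then obtain h where h: "p = 2 * h + 1" using p prime_odd_nat[of p] prime_ge_2_nat[of p]
      by (metis oddE order_le_imp_less_or_eq)
    let ?f = "\<lambda>P Q i. of_nat (p choose i) * Q ^ i * lucV P Q (p - 2 * i)"
    have split: "P ^ p = lucV P Q p + (\<Sum>i\<in>{0<..h}. ?f P Q i)" for P Q
    proof -
      have "{..h} = insert 0 {0<..h}" by auto
      then show ?thesis unfolding h lucV_binomial[of P h Q] by simp
    qed
    have "[(\<Sum>i\<in>{0<..h}. ?f P Q i) = (\<Sum>i\<in>{0<..h}. ?f P' Q' i)] (mod int p ^ (k + 1))"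
    proof (rule cong_sum)
      fix i assume i: "i \<in> {0<..h}"
      then have "p dvd (p choose i)" using p h by (intro dvd_choose_prime) auto
      then obtain c' where c': "p choose i = p * c'" ..
      have "[int p * (int c' * (Q ^ i * lucV P Q (p - 2 * i)))
          = int p * (int c' * (Q' ^ i * lucV P' Q' (p - 2 * i)))] (mod int p ^ (k + 1))"
        by (intro scale cong_mult cong_pow lucV_cong c cong_refl)
      then show "[?f P Q i = ?f P' Q' i] (mod int p ^ (k + 1))"
        by (simp add: c' mult.assoc)
    qed
    from cong_diff[OF lift this] show ?thesis
      using split[of P Q] split[of P' Q'] by simp
  qed
qed

lemma lucV_prime_cong:
  assumes p: "prime p"
  shows "[lucV P Q p = P] (mod int p)"
proof (cases "p = 2")
  case True
  have "[P ^ 2 = P] (mod 2)" using fermat_int[OF p, of P] True by simp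
  moreover have "[2 * Q = 0] (mod 2)" by (simp add: cong_iff_dvd_diff)
  ultimately have "[P ^ 2 - 2 * Q = P - 0] (mod 2)" by (rule cong_diff)
  then show ?thesis using True by (simp add: lucV_2)
next
  case False
  then obtain h where h: "p = 2 * h + 1" using p prime_odd_nat[of p] prime_ge_2_nat[of p]
    by (metis oddE order_le_imp_less_or_eq)
  let ?f = "\<lambda>i. of_nat (p choose i) * Q ^ i * lucV P Q (p - 2 * i)"
  have "{..h} = insert 0 {0<..h}" by auto
  then have "P ^ p = lucV P Q p + (\<Sum>i\<in>{0<..h}. ?f i)"
    unfolding h lucV_binomial[of P h Q] by simp
  moreover have "int p dvd (\<Sum>i\<in>{0<..h}. ?f i)"
  proof (rule dvd_sum)
    fix i assume i: "i \<in> {0<..h}"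
    then have "p dvd (p choose i)" using p h by (intro dvd_choose_prime) auto
    then show "int p dvd ?f i" by (simp add: dvd_mult2)
  qed
  ultimately have "[lucV P Q p = P ^ p] (mod int p)"
    by (simp add: cong_iff_dvd_diff)
  then show ?thesis using fermat_int[OF p, of P] cong_trans by blast
qed

lemma lucV_prime_power_cong:
  assumes p: "prime p"
  shows "[lucV P Q (p ^ Suc k) = lucV P Q (p ^ k)] (mod int p ^ Suc k)"
proof (induction k)
  case 0
  then show ?case using lucV_prime_cong[OF p] by simp
next
  case (Suc k)
  have "[lucV (lucV P Q (p ^ Suc k)) (Q ^ p ^ Suc k) p = lucV (lucV P Q (p ^ k)) (Q ^ p ^ k) p]
    (mod int p ^ (Suc k + 1))"
    by (intro lucV_prime_lift p Suc power_prime_power_cong) simp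
  then show ?case by (simp add: lucV_mult mult.commute)
qed

text \<open>In the expansion of D^h all terms but U_p itself carry a factor p. The power D^h is the
  one that Euler's criterion turns into the Legendre symbol.\<close>

lemma lucU_prime_cong:
  assumes p: "prime p" "p = 2 * h + 1" and D: "lucas_D P Q \<noteq> 0"
  shows "[lucU P Q p = lucas_D P Q ^ h] (mod int p)"
proof -
  let ?f = "\<lambda>i. of_nat (p choose i) * (- Q) ^ i * lucU P Q (p - 2 * i)"
  have "{..h} = insert 0 {0<..h}" by auto
  then have "lucas_D P Q ^ h = lucU P Q p + (\<Sum>i\<in>{0<..h}. ?f i)"
    unfolding p(2) lucU_binomial[OF D, of h] by simp
  moreover have "int p dvd (\<Sum>i\<in>{0<..h}. ?f i)"
  proof (rule dvd_sum)
    fix i assume i: "i \<in> {0<..h}"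
    then have "p dvd (p choose i)" using p by (intro dvd_choose_prime) auto
    then show "int p dvd ?f i" by (simp add: dvd_mult2)
  qed
  ultimately show ?thesis by (simp add: cong_iff_dvd_diff)
qed

section \<open>Divisibility of Lucas numbers by a prime\<close>

lemma prime_not_dvd_coprime_power:
  fixes a :: int
  assumes "prime p" "\<not> int p dvd a"
  shows "coprime a (int p ^ k)"
  using assms by (metis coprime_commute coprime_power_right_iff prime_imp_coprime prime_nat_int_transfer)

lemma fermat_int_coprime:
  fixes a :: int
  assumes "prime p" "\<not> int p dvd a"
  shows "[a ^ (p - 1) = 1] (mod int p)"
proof -
  have "[a ^ (p - 1) * a = 1 * a] (mod int p)"
    using fermat_int[OF assms(1), of a] prime_gt_0_nat[OF assms(1)] by (simp flip: power_Suc2)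
  then show ?thesis
    using prime_not_dvd_coprime_power[OF assms, of 1] by (simp only: cong_mult_rcancel power_one_right)
qed

text \<open>Modulo D both roots become P / 2, and a double root r gives (n + 1) r^n; the power of 2
  clears the denominator.\<close>

lemma lucU_cong_D: "[2 ^ n * lucU P Q (Suc n) = int (Suc n) * P ^ n] (mod lucas_D P Q)"
proof (induction n rule: induct_nat_012)
  case 1
  then show ?case by simp
next
  case (ge2 n)
  have Q: "[4 * Q = P\<^sup>2] (mod lucas_D P Q)"
    by (simp add: cong_iff_dvd_diff lucas_D_def dvd_diff_commute)
  have "2 ^ Suc (Suc n) * lucU P Q (Suc (Suc (Suc n)))
      = 2 * P * (2 ^ Suc n * lucU P Q (Suc (Suc n))) - 4 * Q * (2 ^ n * lucU P Q (Suc n))"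
    by (simp add: algebra_simps)
  moreover have "[\<dots> = 2 * P * (int (Suc (Suc n)) * P ^ Suc n) - P\<^sup>2 * (int (Suc n) * P ^ n)] (mod lucas_D P Q)"
    by (intro cong_diff cong_mult ge2 Q cong_refl)
  moreover have "2 * P * (int (Suc (Suc n)) * P ^ Suc n) - P\<^sup>2 * (int (Suc n) * P ^ n)
      = int (Suc (Suc (Suc n))) * P ^ Suc (Suc n)"
    by (simp add: algebra_simps power2_eq_square)
  ultimately show ?case by simp
qed simp

text \<open>For odd p reduction modulo D leaves n P^(n - 1) up to a power of 2. That power makes the
  reduction uninformative for p = 2, where U_n has the parity of n instead.\<close>

lemma prime_not_dvd_lucU:
  assumes p: "prime p" and D: "int p dvd lucas_D P Q" and Q: "\<not> int p dvd Q" and n: "\<not> p dvd n"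
  shows "\<not> int p dvd lucU P Q n"
proof (cases "p = 2")
  case True
  then have PQ: "even P" "odd Q" using D Q by (auto simp: lucas_D_def)
  have "even (lucU P Q n) \<longleftrightarrow> even n" for n
    by (induction n rule: induct_nat_012) (use PQ in auto)
  then show ?thesis using True n by simp
next
  case False
  have p': "prime (int p)" using p by simp
  obtain m where m: "n = Suc m" using n by (cases n) auto
  have P: "\<not> int p dvd P"
  proof
    assume "int p dvd P"
    then have "int p dvd P\<^sup>2 - lucas_D P Q" using D by (simp add: power2_eq_square)
    then have "int p dvd 4 * Q" by (simp add: lucas_D_def)
    then have "int p dvd 2 * 2" using p' Q by (metis prime_dvd_mult_iff mult_2 numeral_Bit0)
    then have "int p dvd 2" using p' by (metis prime_dvd_mult_iff)
    then show False using False p by (metis primes_dvd_imp_eq two_is_prime_nat of_nat_numeral int_dvd_int_iff)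
  qed
  show ?thesis
  proof
    assume "int p dvd lucU P Q n"
    then have "int p dvd 2 ^ m * lucU P Q (Suc m)" using m by simp
    then have "int p dvd int (Suc m) * P ^ m"
      using cong_dvd_iff[OF cong_dvd_modulus[OF lucU_cong_D D], of m] by simp
    then have "int p dvd int (Suc m) \<or> int p dvd P"
      using p' by (metis prime_dvd_mult_iff prime_dvd_power)
    then show False using P n m by (simp only: int_dvd_int_iff) simp
  qed
qed

lemma lucU_no_consecutive_dvd:
  assumes p: "prime p" and Q: "\<not> int p dvd Q"
  shows "\<not> (int p dvd lucU P Q n \<and> int p dvd lucU P Q (Suc n))"
proof (induction n)
  case 0
  then show ?case using prime_gt_1_nat[OF p] by simp
next
  case (Suc n)
  show ?case
  proof
    assume *: "int p dvd lucU P Q (Suc n) \<and> int p dvd lucU P Q (Suc (Suc n))"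
    then have "int p dvd P * lucU P Q (Suc n) - lucU P Q (Suc (Suc n))" by (intro dvd_diff) auto
    then have "int p dvd Q * lucU P Q n" by simp
    then have "int p dvd lucU P Q n" using p Q by (metis prime_dvd_mult_iff prime_nat_int_transfer)
    then show False using * Suc by simp
  qed
qed

text \<open>Descent from n to n - z through the addition formula: p divides U_z but not U_(z + 1),
  so the latter can be cancelled.\<close>

lemma rank_of_apparition_dvd:
  assumes p: "prime p" and Q: "\<not> int p dvd Q"
    and z: "z > 0" "int p dvd lucU P Q z" "\<And>m. 0 < m \<Longrightarrow> m < z \<Longrightarrow> \<not> int p dvd lucU P Q m"
    and n: "int p dvd lucU P Q n"
  shows "z dvd n"
  using n
proof (induction n rule: less_induct)
  case (less n)
  show ?case
  proof (cases "n < z \<or> n = z")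
    case True
    then show ?thesis using z(3)[of n] less by (cases "n = 0") auto
  next
    case False
    \<comment> \<open>\<open>lucU_add\<close> computes the index one above the sum, hence the shift
      by 1.\<close>
    define m where "m = n - z - 1"
    have m: "n = Suc (z + m)" "n = z + Suc m" using False by (auto simp: m_def)
    have "int p dvd lucU P Q (Suc z) * lucU P Q (Suc m) - Q * lucU P Q z * lucU P Q m"
      using less.prems unfolding m(1) lucU_add .
    then have "int p dvd lucU P Q (Suc z) * lucU P Q (Suc m)"
      using z(2) by (simp add: dvd_diff_left_iff)
    then have "int p dvd lucU P Q (Suc m)"
      using lucU_no_consecutive_dvd[OF p Q, of P z] z(2) p
      by (metis prime_dvd_mult_iff prime_nat_int_transfer)
    then have "z dvd Suc m" using less.IH[of "Suc m"] m(2) z(1) by simp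
    then show ?thesis unfolding m(2) by (simp only: dvd_add_triv_left_iff)
  qed
qed

lemma lucU_Q_0: "lucU P 0 (Suc n) = P ^ n"
  by (induction n rule: induct_nat_012) simp_all

text \<open>Modulo p the parameter Q is 0, and then U_n = P^(n - 1).\<close>

lemma prime_not_dvd_lucU_of_dvd_Q:
  assumes p: "prime p" and "int p dvd Q" "\<not> int p dvd P" "n > 0"
  shows "\<not> int p dvd lucU P Q n"
proof
  obtain m where m: "n = Suc m" using assms(4) by (cases n) auto
  assume "int p dvd lucU P Q n"
  moreover have "[lucU P Q n = lucU P 0 n] (mod int p)"
    by (intro lucU_cong cong_refl) (use assms in \<open>simp add: cong_iff_dvd_diff\<close>)
  ultimately have "int p dvd P ^ m"
    by (simp add: m lucU_Q_0 cong_dvd_iff)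
  then show False using assms(3) p by (metis prime_dvd_power prime_nat_int_transfer)
qed

section \<open>The dual sequence modulo prime powers\<close>

locale nondegenerate_lucas =
  fixes P Q :: int
  assumes Q_nonzero: "Q \<noteq> 0" and D_nonzero: "lucas_D P Q \<noteq> 0" and nondegenerate: "nondegenerate_U P Q"
begin

abbreviation "U \<equiv> lucU P Q"
abbreviation "V \<equiv> lucV P Q"
abbreviation "M \<equiv> dualU P Q"

lemma U_nonzero: "n > 0 \<Longrightarrow> U n \<noteq> 0"
  by (rule lucU_nonzero[OF D_nonzero nondegenerate])

lemma prod_M: "n > 0 \<Longrightarrow> (\<Prod>d | d dvd n. M d) = U n"
  by (rule prod_dualU[OF _ Q_nonzero D_nonzero])

lemma M_dvd_U: "n > 0 \<Longrightarrow> d dvd n \<Longrightarrow> M d dvd U n"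
  by (rule dualU_dvd_lucU[OF _ Q_nonzero D_nonzero])

lemma M_nonzero: "n > 0 \<Longrightarrow> M n \<noteq> 0"
  using M_dvd_U[of n n] U_nonzero[of n] by auto

lemma U_mult: "U m * lucU (V m) (Q ^ m) n = U (m * n)"
  by (rule lucU_mult[OF D_nonzero])

lemma nondegenerate_lucas_V:
  assumes m: "m > 0"
  shows "nondegenerate_lucas (V m) (Q ^ m)"
proof
  show "Q ^ m \<noteq> 0" using Q_nonzero by simp
  show D: "lucas_D (V m) (Q ^ m) \<noteq> 0"
    unfolding lucas_D_lucV using D_nonzero U_nonzero[OF m] by simp
  have "lucU (V m) (Q ^ m) n \<noteq> 0" if "n \<ge> 1" for n
    using U_mult[of m n] U_nonzero[of "m * n"] m that by auto
  then show "nondegenerate_U (V m) (Q ^ m)"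
    unfolding nondegenerate_U_def of_int_lucU[OF D, symmetric] by simp
qed

text \<open>If the entry point z were a proper divisor of n, M_n would divide U_n / U_z, a Lucas
  number of index n / z with parameters (V_z, Q^z). Their discriminant is divisible by p and the
  index is not, so p does not divide the quotient.\<close>

lemma dvd_M_imp_rank:
  assumes p: "prime p" and n: "n > 1" "\<not> p dvd n" and PQ: "\<not> int p dvd gcd P Q"
    and M: "int p dvd M n"
  shows "\<not> int p dvd lucas_D P Q \<and> int p dvd U n \<and> (\<forall>m. 0 < m \<and> m < n \<longrightarrow> \<not> int p dvd U m)"
proof -
  have Un: "int p dvd U n" using M M_dvd_U[of n n] n dvd_trans by auto
  have Q: "\<not> int p dvd Q"
    using prime_not_dvd_lucU_of_dvd_Q[OF p, of Q P n] PQ Un n by auto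
  have D: "\<not> int p dvd lucas_D P Q"
    using prime_not_dvd_lucU[OF p _ Q n(2), of P] Un by auto
  define z where "z = (LEAST z. 0 < z \<and> int p dvd U z)"
  have z: "0 < z" "int p dvd U z"
    using LeastI[of "\<lambda>z. 0 < z \<and> int p dvd U z" n] Un n by (auto simp: z_def)
  have min: "\<not> int p dvd U m" if "0 < m" "m < z" for m
    using not_less_Least[of m "\<lambda>z. 0 < z \<and> int p dvd U z"] that by (auto simp: z_def)
  have "z dvd n" by (rule rank_of_apparition_dvd[OF p Q z min Un])
  then obtain m where m: "n = z * m" by auto
  have "z = n"
  proof (rule ccontr)
    assume "z \<noteq> n"
    let ?S = "{d. d dvd n}" and ?T = "{d. d dvd z}"
    have fin: "finite ?S" using n by simp
    have TS: "?T \<subseteq> ?S" using \<open>z dvd n\<close> by (auto intro: dvd_trans)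
    have "U z * lucU (V z) (Q ^ z) m = U n" unfolding m by (rule U_mult)
    also have "\<dots> = (\<Prod>d\<in>?S - ?T. M d) * U z"
      using prod.subset_diff[OF TS fin, of M] prod_M[of n] prod_M[of z] n z by simp
    finally have "lucU (V z) (Q ^ z) m = (\<Prod>d\<in>?S - ?T. M d)"
      using U_nonzero[OF z(1)] by simp
    moreover have "n \<in> ?S - ?T"
      using \<open>z \<noteq> n\<close> \<open>z dvd n\<close> by (auto dest: dvd_antisym)
    ultimately have "int p dvd lucU (V z) (Q ^ z) m"
      using M fin by (metis dvd_prodI dvd_trans finite_Diff)
    moreover have "\<not> int p dvd lucU (V z) (Q ^ z) m"
    proof (rule prime_not_dvd_lucU[OF p])
      show "int p dvd lucas_D (V z) (Q ^ z)" using z by (simp add: lucas_D_lucV power2_eq_square)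
      show "\<not> int p dvd Q ^ z" using Q p by (metis prime_dvd_power prime_nat_int_transfer)
      show "\<not> p dvd m" using n m by auto
    qed
    ultimately show False by simp
  qed
  then show ?thesis using D Un min by auto
qed

end

section \<open>Indices divisible by a power of p\<close>

locale nondegenerate_lucas_prime = nondegenerate_lucas +
  fixes p :: nat
  assumes prime_p: "prime p"
begin

lemma p_pos: "p > 0" using prime_p by (rule prime_gt_0_nat)

lemma prime_int_p: "prime (int p)" using prime_p by simp

text \<open>A divisor of p^(k + 1) n either divides p^k n or is p^(k + 1) d with d dividing n; the
  second kind accounts for the quotient U_(p^(k + 1) n) / U_(p^k n).\<close>

lemma prod_M_prime_power:
  assumes "n > 0" "\<not> p dvd n"
  shows "(\<Prod>d | d dvd n. M (p ^ Suc k * d)) = lucU (V (p ^ k * n)) (Q ^ (p ^ k * n)) p"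
proof -
  let ?A = "{d. d dvd p ^ k * n}" and ?B = "(*) (p ^ Suc k) ` {d. d dvd n}"
  have pos: "p ^ k * n > 0" using assms p_pos by simp
  have un: "{d. d dvd p ^ Suc k * n} = ?A \<union> ?B"
  proof (intro equalityI subsetI)
    fix d assume d: "d \<in> {d. d dvd p ^ Suc k * n}"
    then obtain x y where xy: "d = x * y" "x dvd p ^ Suc k" "y dvd n"
      using division_decomp by blast
    then obtain i where i: "i \<le> Suc k" "x = p ^ i"
      using divides_primepow_nat[OF prime_p] by blast
    show "d \<in> ?A \<union> ?B"
    proof (cases "i = Suc k")
      case True
      then show ?thesis using xy i by auto
    next
      case False
      then have "x dvd p ^ k" using i by (simp add: le_imp_power_dvd)
      then show ?thesis using xy by (auto intro: mult_dvd_mono)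
    qed
  next
    fix d assume "d \<in> ?A \<union> ?B"
    then consider "d dvd p ^ k * n" | e where "d = p ^ Suc k * e" "e dvd n" by auto
    then show "d \<in> {d. d dvd p ^ Suc k * n}"
    proof cases
      case 1
      have "p ^ k * n dvd p ^ Suc k * n" by simp
      then show ?thesis using 1 by (metis dvd_trans mem_Collect_eq)
    next
      case 2
      then show ?thesis by simp
    qed
  qed
  have disj: "?A \<inter> ?B = {}"
  proof (rule ccontr)
    assume "?A \<inter> ?B \<noteq> {}"
    then obtain e where "p ^ Suc k * e dvd p ^ k * n" by blast
    then have "p ^ k * p dvd p ^ k * n" by (metis dvd_mult_left power_Suc2)
    then have "p dvd n" using p_pos by simp
    then show False using assms by simp
  qed
  have "U (p ^ k * n) * lucU (V (p ^ k * n)) (Q ^ (p ^ k * n)) p = U (p ^ Suc k * n)"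
    by (simp add: U_mult mult_ac)
  also have "\<dots> = (\<Prod>d\<in>?A \<union> ?B. M d)"
    using prod_M[of "p ^ Suc k * n"] assms p_pos unfolding un by simp
  also have "\<dots> = U (p ^ k * n) * (\<Prod>d\<in>?B. M d)"
    using disj assms p_pos prod_M[OF pos] by (subst prod.union_disjoint) auto
  also have "(\<Prod>d\<in>?B. M d) = (\<Prod>d | d dvd n. M (p ^ Suc k * d))"
    using p_pos by (subst prod.reindex) (auto simp: inj_on_def)
  finally show ?thesis using U_nonzero[OF pos] by simp
qed

lemma M_prime_power: "M (p ^ Suc k) = lucU (V (p ^ k)) (Q ^ (p ^ k)) p"
  using prod_M_prime_power[of 1 k] prime_gt_1_nat[OF prime_p] by simp

text \<open>
  This is \<open>\<Phi>\<^sub>n (x ^ (p * q)) = \<Phi>\<^sub>n (x ^ q) * \<Phi>\<^bsub>p * q * n\<^esub> (x)\<close> with \<open>q = p ^ k\<close>, in homogeneous form.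
\<close>

lemma dualU_V_prime_power:
  assumes "n > 1" "\<not> p dvd n"
  shows "dualU (V (p ^ Suc k)) (Q ^ p ^ Suc k) n
    = dualU (V (p ^ k)) (Q ^ p ^ k) n * M (p ^ Suc k * n)"
  using assms
proof (induction n rule: less_induct)
  case (less n)
  let ?F = "\<lambda>k. dualU (V (p ^ k)) (Q ^ p ^ k)" and ?R = "\<lambda>d. M (p ^ Suc k * d)"
  interpret F: nondegenerate_lucas "V (p ^ j)" "Q ^ p ^ j" for j
    using p_pos by (intro nondegenerate_lucas_V) simp
  have n: "n > 0" using less.prems by simp
  let ?S = "{d. d dvd n} - {1}"
  have fin: "finite {d. d dvd n}" "finite (?S - {n})" using n by auto
  have split1: "(\<Prod>d | d dvd n. f d) = f 1 * (\<Prod>d\<in>?S. f d)" for f :: "nat \<Rightarrow> int"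
    using fin by (subst prod.remove[of _ 1]) auto
  have splitn: "(\<Prod>d\<in>?S. f d) = f n * (\<Prod>d\<in>?S - {n}. f d)" for f :: "nat \<Rightarrow> int"
    using fin less.prems by (subst prod.remove[of _ n]) auto
  have U: "U (p ^ k) * (\<Prod>d\<in>?S. ?F k d) = U (p ^ k * n)" for k
    using U_mult[of "p ^ k" n] F.prod_M[OF n, of k] by (simp add: split1)
  \<comment> \<open>U_(p^(k + 1) n) is factored in two ways: through the divisors of n at level k +
    1, and through those at level k together with the new divisors p^(k + 1) d. The factors with 1 <
    d < n then cancel by induction.\<close>
  have "U (p ^ Suc k) * (\<Prod>d\<in>?S. ?F (Suc k) d) = U (p ^ k * n) * lucU (V (p ^ k * n)) (Q ^ (p ^ k * n)) p"
    unfolding U by (simp add: U_mult mult_ac)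
  also have "\<dots> = U (p ^ k) * ?R 1 * (\<Prod>d\<in>?S. ?F k d * ?R d)"
    unfolding prod_M_prime_power[OF n less.prems(2), symmetric] U[symmetric] split1 prod.distrib
    by (simp only: mult_ac)
  also have "U (p ^ k) * ?R 1 = U (p ^ Suc k)"
    using M_prime_power[of k] U_mult[of "p ^ k" p] by (simp add: mult.commute)
  finally have "(\<Prod>d\<in>?S. ?F (Suc k) d) = (\<Prod>d\<in>?S. ?F k d * ?R d)"
    using U_nonzero[of "p ^ Suc k"] p_pos by simp
  then have "?F (Suc k) n * (\<Prod>d\<in>?S - {n}. ?F (Suc k) d)
      = (?F k n * ?R n) * (\<Prod>d\<in>?S - {n}. ?F k d * ?R d)"
    unfolding splitn .
  also have "(\<Prod>d\<in>?S - {n}. ?F k d * ?R d) = (\<Prod>d\<in>?S - {n}. ?F (Suc k) d)"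
  proof (rule prod.cong[OF refl])
    fix d assume d: "d \<in> ?S - {n}"
    then have "d < n" using n by (auto dest: dvd_imp_le)
    moreover have "d > 0" using d n by (auto intro: Nat.gr0I)
    then have "d > 1" using d by auto
    moreover have "\<not> p dvd d" using d less.prems by (auto dest: dvd_trans)
    ultimately show "?F k d * ?R d = ?F (Suc k) d" by (rule less.IH[symmetric])
  qed
  finally have "?F (Suc k) n * (\<Prod>d\<in>?S - {n}. ?F (Suc k) d)
      = (?F k n * ?R n) * (\<Prod>d\<in>?S - {n}. ?F (Suc k) d)" .
  moreover have "(\<Prod>d\<in>?S - {n}. ?F (Suc k) d) \<noteq> 0"
    using fin n F.M_nonzero[of _ "Suc k"] by (auto simp: prod_zero_iff intro: Nat.gr0I)
  ultimately show ?case by (simp only: mult_cancel_right) simp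
qed

lemma V_prime_power_cong: "[V (p ^ k) = P] (mod int p)"
proof (induction k)
  case (Suc k)
  have "[V (p ^ Suc k) = V (p ^ k)] (mod int p)"
    using lucV_prime_power_cong[OF prime_p, of P Q k] by (rule cong_dvd_modulus) simp
  then show ?case using Suc cong_trans by blast
qed simp

lemma Q_prime_power_cong: "[Q ^ p ^ k = Q] (mod int p)"
proof (induction k)
  case (Suc k)
  have "[Q ^ p ^ Suc k = Q ^ p ^ k] (mod int p)"
    using power_prime_power_cong[OF prime_p, of Q k] by (rule cong_dvd_modulus) simp
  then show ?case using Suc cong_trans by blast
qed simp

lemma dualU_V_cong: "[dualU (V (p ^ k)) (Q ^ p ^ k) n = M n] (mod int p)"
  by (intro dualU_cong V_prime_power_cong Q_prime_power_cong)

text \<open>The exponent j is left free: for p = 2 dividing D, the values at consecutive levels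
  agree to one power more than the general congruence of the parameters provides.\<close>

lemma M_cong_1_of_dualU_cong:
  assumes n: "n > 1" "\<not> p dvd n" and M: "\<not> int p dvd M n"
    and c: "[dualU (V (p ^ Suc k)) (Q ^ p ^ Suc k) n = dualU (V (p ^ k)) (Q ^ p ^ k) n] (mod int p ^ j)"
  shows "[M (p ^ Suc k * n) = 1] (mod int p ^ j)"
proof -
  let ?F = "dualU (V (p ^ k)) (Q ^ p ^ k) n"
  have "\<not> int p dvd ?F" using M cong_dvd_iff[OF dualU_V_cong] by blast
  then have "coprime ?F (int p ^ j)" by (rule prime_not_dvd_coprime_power[OF prime_p])
  moreover have "[?F * M (p ^ Suc k * n) = ?F * 1] (mod int p ^ j)"
    using c unfolding dualU_V_prime_power[OF n] by simp
  ultimately show ?thesis using cong_mult_lcancel by blast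
qed

lemma M_cong_1:
  assumes "n > 1" "\<not> p dvd n" "\<not> int p dvd M n"
  shows "[M (p ^ Suc k * n) = 1] (mod int p ^ Suc k)"
  using assms
  by (intro M_cong_1_of_dualU_cong dualU_cong lucV_prime_power_cong power_prime_power_cong prime_p)

end

section \<open>The refined congruences\<close>

lemma prime_power_lift_cong:
  fixes a b :: int
  assumes "[a = b] (mod int p)"
  shows "[a ^ (p ^ k) = b ^ (p ^ k)] (mod int p ^ Suc k)"
proof (induction k)
  case (Suc k)
  from cong_power_prime_lift[OF _ this] show ?case
    by (simp add: mult.commute flip: power_mult)
qed (use assms in simp)

section \<open>Powers of 2 and expansion to second order in D\<close>

lemma odd_square_cong_1:
  fixes a :: int
  assumes "odd a"
  shows "[a\<^sup>2 = 1] (mod 8)"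
proof -
  obtain b where b: "a = 2 * b + 1" using assms by (elim oddE)
  have "even (b * (b + 1))" by simp
  then obtain c where "b * (b + 1) = 2 * c" by (elim evenE)
  then have "a\<^sup>2 - 1 = 8 * c" unfolding b by (simp add: power2_eq_square algebra_simps)
  then show ?thesis by (simp add: cong_iff_dvd_diff)
qed

lemma cong_double:
  fixes a b :: int
  assumes "[a = b] (mod 2 ^ k)"
  shows "[2 * a = 2 * b] (mod 2 ^ Suc k)"
proof -
  have "2 * 2 ^ k dvd 2 * (a - b)"
    using assms by (intro mult_dvd_mono) (simp_all add: cong_iff_dvd_diff)
  then show ?thesis unfolding cong_iff_dvd_diff right_diff_distrib power_Suc .
qed

lemma odd_power_two_power_cong:
  fixes a :: int
  assumes "odd a"
  shows "[a ^ (2 ^ Suc k) = 1] (mod 2 ^ (k + 3))"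
proof (induction k)
  case 0
  then show ?case using odd_square_cong_1[OF assms] by simp
next
  case (Suc k)
  have "[(a ^ 2 ^ Suc k) ^ 2 = 1 ^ 2] (mod 2 ^ (k + 3 + 1))"
    using cong_power_prime_lift[of "k + 3" "a ^ 2 ^ Suc k" 1 2] Suc by simp
  moreover have "(a ^ 2 ^ Suc k) ^ 2 = a ^ 2 ^ Suc (Suc k)"
    by (simp only: power_mult[symmetric] power_Suc2[of 2 "Suc k"])
  ultimately show ?case by (simp add: add.commute)
qed

text \<open>V_2 is twice an odd number, which may be 1 or -1 modulo 4; so V_2 is not determined
  modulo 8, but its square is determined modulo 16.\<close>

lemma lucV_2_square_cong:
  assumes "even P" "odd Q"
  shows "[(lucV P Q 2)\<^sup>2 = 4] (mod 16)"
proof -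
  obtain b where b: "P = 2 * b" using assms by (elim evenE)
  define w where "w = 2 * b\<^sup>2 - Q"
  have w: "lucV P Q 2 = 2 * w"
    by (simp add: b w_def lucV_2 power2_eq_square algebra_simps)
  have "[w\<^sup>2 = 1] (mod 8)"
    using assms by (intro odd_square_cong_1) (simp add: w_def)
  then have "8 dvd w\<^sup>2 - 1" by (simp add: cong_iff_dvd_diff)
  then have "16 dvd 4 * w\<^sup>2 - 4" by presburger
  then show ?thesis by (simp add: w cong_iff_dvd_diff power_mult_distrib)
qed

text \<open>2 is a fixed point of v^2 - 2, the form taken by the doubling formula once Q^m is close
  to 1; each squaring adds a factor 2 to the modulus. The indices start at 4 because V_2 may be -2
  modulo 8.\<close>

lemma lucV_two_power_cong:
  assumes "even P" "odd Q"
  shows "[lucV P Q (2 ^ (k + 2)) = 2] (mod 2 ^ (k + 4))"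
proof (induction k)
  case 0
  have "lucV P Q 4 = (lucV P Q 2)\<^sup>2 - 2 * Q\<^sup>2"
    using lucV_double[of P Q 2] by simp
  moreover have "[2 * Q\<^sup>2 = 2 * 1] (mod 2 ^ Suc 3)"
    by (rule cong_double) (use odd_square_cong_1[OF assms(2)] in simp)
  ultimately show ?case
    using cong_diff[OF lucV_2_square_cong[OF assms]] by fastforce
next
  case (Suc k)
  have "lucV P Q (2 ^ (Suc k + 2)) = (lucV P Q (2 ^ (k + 2)))\<^sup>2 - 2 * Q ^ 2 ^ (k + 2)"
    using lucV_double[of P Q "2 ^ (k + 2)"] by simp
  moreover have "[2 * Q ^ 2 ^ (k + 2) = 2 * 1] (mod 2 ^ Suc (k + 4))"
    using odd_power_two_power_cong[OF assms(2), of "k + 1"]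
    by (intro cong_double) (simp add: add.commute)
  moreover have "[(lucV P Q (2 ^ (k + 2)))\<^sup>2 = 2\<^sup>2] (mod 2 ^ Suc (k + 4))"
    using cong_power_prime_lift[of "k + 4" "lucV P Q (2 ^ (k + 2))" 2 2] Suc by simp
  ultimately show ?case
    using cong_diff by fastforce
qed

text \<open>totient n is even for n > 2, so only even powers of P occur. This removes the ambiguity
  in the sign of V_2.\<close>

lemma dualU_cong_square:
  assumes "n > 2" "[P\<^sup>2 = P'\<^sup>2] (mod m)" "[Q = Q'] (mod m)"
  shows "[dualU P Q n = dualU P' Q' n] (mod m)"
proof -
  obtain h where h: "totient n = 2 * h" using totient_even[OF assms(1)] by (elim evenE)
  have "P ^ (totient n - 2 * j) = (P\<^sup>2) ^ (h - j)" for P :: int and j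
    by (simp add: h right_diff_distrib' flip: power_mult)
  then show ?thesis
    unfolding dualU_def using assms by (auto intro!: cong_sum cong_mult cong_pow)
qed

text \<open>These are the first two terms of 2^(m - 1) U_m = sum over i of (m choose 2 i + 1) P^(m -
  1 - 2 i) D^i, with m = n + 3 so that the second exponent of P is n.\<close>

lemma lucU_cong_D_square:
  "[2 ^ (n + 2) * lucU P Q (n + 3) = int (n + 3) * P ^ (n + 2)
     + int ((n + 3) choose 3) * P ^ n * lucas_D P Q] (mod (lucas_D P Q)\<^sup>2)"
proof (induction n rule: induct_nat_012)
  case 0
  then show ?case by (simp add: numeral_3_eq_3 lucas_D_def power2_eq_square algebra_simps)
next
  case 1
  have "(4::nat) choose 3 = 4" by (simp add: eval_nat_numeral)
  moreover have "lucU P Q 4 = P ^ 3 - 2 * P * Q"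
    by (simp add: eval_nat_numeral algebra_simps)
  then have "8 * lucU P Q 4 = 4 * P ^ 3 + 4 * P * lucas_D P Q"
    by (simp add: lucas_D_def power3_eq_cube power2_eq_square algebra_simps)
  ultimately show ?case by (simp add: power3_eq_cube mult.assoc)
next
  case (ge2 n)
  let ?D = "lucas_D P Q"
  let ?f = "\<lambda>n. int (n + 3) * P ^ (n + 2) + int ((n + 3) choose 3) * P ^ n * ?D"
  have rec: "2 ^ (Suc (Suc n) + 2) * lucU P Q (Suc (Suc n) + 3)
      = 2 * P * (2 ^ (Suc n + 2) * lucU P Q (Suc n + 3)) - 4 * Q * (2 ^ (n + 2) * lucU P Q (n + 3))"
    by (simp add: numeral_3_eq_3 algebra_simps)
  \<comment> \<open>The second difference of m choose 3 is m; it absorbs the contribution of -D in 4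
    Q = P^2 - D.\<close>
  have "(Suc (Suc m) choose 3) + (m choose 3) = 2 * (Suc m choose 3) + m" for m
    by (simp add: numeral_3_eq_3)
  from this[of "n + 3"]
  have "((Suc (Suc n) + 3) choose 3) + ((n + 3) choose 3) = 2 * ((Suc n + 3) choose 3) + (n + 3)"
    by (simp only: add_Suc)
  then have ch: "int ((Suc (Suc n) + 3) choose 3)
      = 2 * int ((Suc n + 3) choose 3) + int (n + 3) - int ((n + 3) choose 3)"
    by linarith
  have Q: "4 * Q = P\<^sup>2 - ?D" by (simp add: lucas_D_def)
  have e: "2 * P * ?f (Suc n) - 4 * Q * ?f n = ?f (Suc (Suc n)) + ?D\<^sup>2 * (int ((n + 3) choose 3) * P ^ n)"
    unfolding Q ch by (simp add: algebra_simps power2_eq_square)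
  have c: "[2 * P * (2 ^ (Suc n + 2) * lucU P Q (Suc n + 3)) - 4 * Q * (2 ^ (n + 2) * lucU P Q (n + 3))
      = 2 * P * ?f (Suc n) - 4 * Q * ?f n] (mod ?D\<^sup>2)"
    by (intro cong_diff cong_mult ge2 cong_refl)
  have "[?f (Suc (Suc n)) + ?D\<^sup>2 * (int ((n + 3) choose 3) * P ^ n) = ?f (Suc (Suc n))] (mod ?D\<^sup>2)"
    by (simp add: cong_iff_dvd_diff)
  from cong_trans[OF c[unfolded e] this] show ?case unfolding rec .
qed

section \<open>An odd prime dividing the discriminant\<close>

locale odd_prime_dividing_D =
  fixes P Q :: int and p h :: nat
  assumes p: "prime p" "p = 2 * h + 1"
    and D_nonzero: "lucas_D P Q \<noteq> 0" and D: "int p dvd lucas_D P Q" and Q: "\<not> int p dvd Q"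
begin

lemma prime_int_p: "prime (int p)" using p(1) by simp

lemma not_dvd_2: "\<not> int p dvd 2"
proof
  assume "int p dvd 2"
  then have "p dvd 2" by (metis int_dvd_int_iff of_nat_numeral)
  then have "p = 2" using primes_dvd_imp_eq[OF p(1) two_is_prime_nat] by simp
  then show False using p(2) by presburger
qed

lemma coprime_2_power: "coprime (2 ^ i) (int p ^ j)"
  using prime_not_dvd_coprime_power[OF p(1) not_dvd_2] by simp

lemma not_dvd_P: "\<not> int p dvd P"
proof
  assume "int p dvd P"
  then have "int p dvd P\<^sup>2 - lucas_D P Q" using D by (simp add: power2_eq_square)
  then have "int p dvd 2 * (2 * Q)" by (simp add: lucas_D_def)
  then show False using prime_int_p not_dvd_2 Q by (metis prime_dvd_mult_iff)
qed

text \<open>Each step from p^k to p^(k + 1) multiplies by a Lucas number of index p, and reduction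
  modulo its discriminant makes this index a factor.\<close>

lemma p_power_dvd_lucU: "int p ^ k dvd lucU P Q (p ^ k)"
proof (induction k)
  case (Suc k)
  let ?P = "lucV P Q (p ^ k)" and ?Q = "Q ^ p ^ k"
  have "int p dvd lucas_D ?P ?Q" using D by (simp add: lucas_D_lucV)
  then have "[2 ^ (2 * h) * lucU ?P ?Q p = int p * ?P ^ (2 * h)] (mod int p)"
    using lucU_cong_D[of "2 * h" ?P ?Q] p(2) cong_dvd_modulus by simp
  then have "int p dvd 2 ^ (2 * h) * lucU ?P ?Q p"
    by (simp add: cong_dvd_iff)
  then have "int p dvd lucU ?P ?Q p"
    using prime_int_p not_dvd_2 by (metis prime_dvd_mult_iff prime_dvd_power)
  then have "int p ^ k * int p dvd lucU P Q (p ^ k) * lucU ?P ?Q p"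
    using Suc by (intro mult_dvd_mono)
  then show ?case by (simp add: lucU_mult[OF D_nonzero] mult.commute)
qed simp

text \<open>Since 4 Q = P^2 modulo p, Q is a nonzero square modulo p, and h = (p - 1) / 2.\<close>

lemma Q_power_cong: "[Q ^ h = 1] (mod int p)"
proof -
  have "(4 :: int) ^ h = 2 ^ (p - 1)" using p(2) by (simp add: power_mult)
  then have 4: "[4 ^ h = 1] (mod int p)"
    using fermat_int_coprime[OF p(1) not_dvd_2] by simp
  have "[4 * Q = P\<^sup>2] (mod int p)"
    using D by (simp add: cong_iff_dvd_diff lucas_D_def dvd_diff_commute)
  then have "[(4 * Q) ^ h = (P\<^sup>2) ^ h] (mod int p)" by (rule cong_pow)
  also have "(P\<^sup>2) ^ h = P ^ (p - 1)" using p(2) by (simp add: power_mult)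
  also have "[P ^ (p - 1) = 1] (mod int p)" by (rule fermat_int_coprime[OF p(1) not_dvd_P])
  finally have c: "[4 ^ h * Q ^ h = 1] (mod int p)" by (simp add: power_mult_distrib)
  have "[4 ^ h * Q ^ h = 1 * Q ^ h] (mod int p)" by (intro cong_mult 4 cong_refl)
  from cong_trans[OF cong_sym[OF this] c] show ?thesis by simp
qed

lemma D_lucV_dvd: "int p ^ (2 * k) * lucas_D P Q dvd lucas_D (lucV P Q (p ^ k)) (Q ^ p ^ k)"
proof -
  have "lucas_D P Q * (int p ^ k)\<^sup>2 dvd lucas_D P Q * (lucU P Q (p ^ k))\<^sup>2"
    using p_power_dvd_lucU by (intro mult_dvd_mono dvd_power_same) auto
  then show ?thesis by (simp add: lucas_D_lucV mult.commute flip: power_mult)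
qed

lemma p_power_dvd_D_lucV: "int p ^ Suc (2 * k) dvd lucas_D (lucV P Q (p ^ k)) (Q ^ p ^ k)"
proof -
  have "int p ^ (2 * k) * int p dvd int p ^ (2 * k) * lucas_D P Q"
    using D by (intro mult_dvd_mono) auto
  from dvd_trans[OF this D_lucV_dvd] show ?thesis by (simp only: power_Suc2)
qed

text \<open>Modulo the discriminant V^2 = 4 Q^(p^k), so the power p - 1 of V is 4^h (Q^h)^(p^k), and
  raising Q^h = 1 modulo p to the power p^k gives the modulus p^(k + 1). The result matches the
  power of 2 in the expansion of U_p.\<close>

lemma lucV_power_cong: "[lucV P Q (p ^ k) ^ (2 * h) = 2 ^ (2 * h)] (mod int p ^ Suc k)"
proof -
  let ?P = "lucV P Q (p ^ k)" and ?Q = "Q ^ p ^ k"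
  have "int p ^ Suc k dvd int p ^ Suc (2 * k)" by (intro le_imp_power_dvd) simp
  then have "int p ^ Suc k dvd lucas_D ?P ?Q" using p_power_dvd_D_lucV dvd_trans by blast
  then have "[?P\<^sup>2 = 4 * ?Q] (mod int p ^ Suc k)"
    by (simp add: cong_iff_dvd_diff lucas_D_def)
  then have "[(?P\<^sup>2) ^ h = (4 * ?Q) ^ h] (mod int p ^ Suc k)" by (rule cong_pow)
  also have "(4 * ?Q) ^ h = 4 ^ h * (Q ^ h) ^ p ^ k"
    by (simp add: power_mult_distrib mult.commute flip: power_mult)
  also have "[\<dots> = 4 ^ h * 1 ^ p ^ k] (mod int p ^ Suc k)"
    by (intro cong_mult cong_refl prime_power_lift_cong Q_power_cong)
  finally show ?thesis by (simp add: power_mult)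
qed

lemma p_lucV_power_cong: "[int p * lucV P Q (p ^ k) ^ (2 * h) = 2 ^ (2 * h) * int p] (mod int p ^ (k + 2))"
proof -
  have "int p * int p ^ Suc k dvd int p * (lucV P Q (p ^ k) ^ (2 * h) - 2 ^ (2 * h))"
    using lucV_power_cong[of k] by (intro mult_dvd_mono) (simp_all only: cong_iff_dvd_diff dvd_refl)
  then show ?thesis by (simp add: cong_iff_dvd_diff right_diff_distrib mult.commute)
qed

lemma lucU_p_cong:
  "[lucU (lucV P Q (p ^ k)) (Q ^ p ^ k) p = int p] (mod int p ^ Suc k)"
proof -
  let ?P = "lucV P Q (p ^ k)" and ?Q = "Q ^ p ^ k"
  have "int p ^ Suc k dvd int p ^ Suc (2 * k)" by (intro le_imp_power_dvd) simp
  then have "int p ^ Suc k dvd lucas_D ?P ?Q" using p_power_dvd_D_lucV dvd_trans by blast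
  then have "[2 ^ (2 * h) * lucU ?P ?Q p = int p * ?P ^ (2 * h)] (mod int p ^ Suc k)"
    using lucU_cong_D[of "2 * h" ?P ?Q] p(2) cong_dvd_modulus by simp
  also have "[int p * ?P ^ (2 * h) = 2 ^ (2 * h) * int p] (mod int p ^ Suc k)"
    using p_lucV_power_cong[of k] by (rule cong_dvd_modulus) simp
  finally show ?thesis using coprime_2_power cong_mult_lcancel by blast
qed

text \<open>The discriminant at level p^k is divisible by p^(2 k + 1). The term linear in it is
  divisible by p^(k + 2) for one of three reasons: p divides p choose 3, or 2 k + 1 >= k + 2, or D
  contributes a second p. The last one serves p = 3, k = 0 at the entry point n, where the locale is
  applied to (V_n, Q^n).\<close>

lemma lucU_p_cong_strong:
  assumes "p > 3 \<or> k \<ge> 1 \<or> (int p)\<^sup>2 dvd lucas_D P Q"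
  shows "[lucU (lucV P Q (p ^ k)) (Q ^ p ^ k) p = int p] (mod int p ^ (k + 2))"
proof -
  let ?P = "lucV P Q (p ^ k)" and ?Q = "Q ^ p ^ k" and ?m = "int p ^ (k + 2)"
  let ?D = "lucas_D ?P ?Q"
  define n where "n = 2 * h - 2"
  have n: "2 * h = n + 2" "p = n + 3"
    using p(2) prime_gt_1_nat[OF p(1)] by (simp_all add: n_def)
  have C: "?m dvd int (p choose 3) * ?P ^ n * ?D"
  proof -
    consider "p > 3" | "k \<ge> 1" | "(int p)\<^sup>2 dvd lucas_D P Q" using assms by blast
    then have "?m dvd int (p choose 3) * ?D"
    proof cases
      case 1
      then have "int p dvd int (p choose 3)"
        unfolding int_dvd_int_iff using p(1) by (intro dvd_choose_prime) auto
      then have "int p * int p ^ Suc (2 * k) dvd int (p choose 3) * ?D"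
        using p_power_dvd_D_lucV by (intro mult_dvd_mono)
      moreover have "?m dvd int p * int p ^ Suc (2 * k)"
        unfolding power_Suc[symmetric] by (intro le_imp_power_dvd) simp
      ultimately show ?thesis by (rule dvd_trans[rotated])
    next
      case 2
      have "?m dvd int p ^ Suc (2 * k)" using 2 by (intro le_imp_power_dvd) simp
      from dvd_trans[OF this p_power_dvd_D_lucV] show ?thesis by (rule dvd_mult)
    next
      case 3
      have "?m dvd int p ^ (2 * k) * (int p)\<^sup>2"
        unfolding power_add[symmetric] by (intro le_imp_power_dvd) simp
      also have "\<dots> dvd int p ^ (2 * k) * lucas_D P Q"
        using 3 by (intro mult_dvd_mono) auto
      also have "\<dots> dvd ?D" by (rule D_lucV_dvd)
      finally show ?thesis by (rule dvd_mult)
    qed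
    then have "?m dvd (int (p choose 3) * ?D) * ?P ^ n" by (rule dvd_mult2)
    then show ?thesis by (simp only: mult_ac)
  qed
  have "?m dvd ?D\<^sup>2"
  proof -
    have "(int p ^ Suc (2 * k))\<^sup>2 dvd ?D\<^sup>2" using p_power_dvd_D_lucV by (rule dvd_power_same)
    moreover have "?m dvd (int p ^ Suc (2 * k))\<^sup>2"
      unfolding power_mult[symmetric] by (intro le_imp_power_dvd) simp
    ultimately show ?thesis by (rule dvd_trans[rotated])
  qed
  from cong_dvd_modulus[OF lucU_cong_D_square this, of n]
  have "[2 ^ (2 * h) * lucU ?P ?Q p = int p * ?P ^ (2 * h) + int (p choose 3) * ?P ^ n * ?D] (mod ?m)"
    unfolding n .
  also have "[int p * ?P ^ (2 * h) + int (p choose 3) * ?P ^ n * ?D = 2 ^ (2 * h) * int p + 0] (mod ?m)"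
    by (intro cong_add p_lucV_power_cong) (use C in \<open>simp add: cong_iff_dvd_diff\<close>)
  finally have "[2 ^ (2 * h) * lucU ?P ?Q p = 2 ^ (2 * h) * int p] (mod ?m)" by simp
  then show ?thesis using coprime_2_power cong_mult_lcancel by blast
qed

end

section \<open>The sharper modulus for p = 2 and the Kronecker symbol\<close>

context nondegenerate_lucas_prime
begin

text \<open>As n > 2, it suffices to compare squares of V at consecutive levels. This matters at the
  lowest level, where V_4 is 2 modulo 8 but V_2 may be -2.\<close>

lemma M_two_power_cong_1:
  assumes "p = 2" "even P" "odd Q" "n > 1" "odd n" "\<not> 2 dvd M n"
  shows "[M (2 ^ (k + 2) * n) = 1] (mod 2 ^ (k + 3))"
proof -
  have "[(V (2 ^ (k + 2)))\<^sup>2 = (V (2 ^ (k + 1)))\<^sup>2] (mod 2 ^ (k + 3))"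
  proof (cases k)
    case 0
    have c: "[(V 2)\<^sup>2 = 2\<^sup>2] (mod 8)"
      using lucV_2_square_cong[OF assms(2,3)] by (auto elim: cong_dvd_modulus)
    have "[V 4 = 2] (mod 8)"
      using lucV_two_power_cong[OF assms(2,3), of 0] by (simp add: cong_iff_dvd_diff)  presburger
    then have "[(V 4)\<^sup>2 = 2\<^sup>2] (mod 8)" by (rule cong_pow)
    from cong_trans[OF this cong_sym[OF c]] show ?thesis using 0 by simp
  next
    case (Suc j)
    have c: "[V (2 ^ (k + 2)) = 2] (mod 2 ^ (k + 3))"
      using lucV_two_power_cong[OF assms(2,3), of k] by (rule cong_dvd_modulus) (simp add: le_imp_power_dvd)
    have "[V (2 ^ (k + 1)) = 2] (mod 2 ^ (k + 3))"
      using lucV_two_power_cong[OF assms(2,3), of j] Suc by (simp add: add.commute)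
    from cong_pow[OF cong_trans[OF c cong_sym[OF this]]] show ?thesis .
  qed
  moreover have "[Q ^ 2 ^ (k + 2) = Q ^ 2 ^ (k + 1)] (mod 2 ^ (k + 3))"
  proof -
    have "[Q ^ 2 ^ Suc (Suc k) = 1] (mod 2 ^ (k + 3))"
      using odd_power_two_power_cong[OF assms(3), of "Suc k"]
      by (rule cong_dvd_modulus) (simp add: le_imp_power_dvd)
    from cong_trans[OF this cong_sym[OF odd_power_two_power_cong[OF assms(3), of k]]]
    show ?thesis by simp
  qed
  moreover have "n > 2" using assms(4,5) by (cases "n = 2") auto
  ultimately have "[dualU (V (2 ^ (k + 2))) (Q ^ 2 ^ (k + 2)) n
      = dualU (V (2 ^ (k + 1))) (Q ^ 2 ^ (k + 1)) n] (mod 2 ^ (k + 3))"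
    by (intro dualU_cong_square)
  then show ?thesis
    using M_cong_1_of_dualU_cong[of n "k + 1" "k + 3"] assms by simp
qed

lemma M_p_power_kronecker:
  assumes D: "\<not> int p dvd lucas_D P Q"
  shows "[M (p ^ Suc k) = kronecker_prime (lucas_D P Q) p] (mod int p ^ Suc k)"
proof (cases "p = 2")
  case True
  define e :: int where "e = kronecker_prime (lucas_D P Q) p"
  have odd_P: "odd P" using D True by (simp add: lucas_D_def)
  have P8: "[P\<^sup>2 = 1] (mod 8)" by (rule odd_square_cong_1[OF odd_P])
  \<comment> \<open>D = 1 - 4 Q modulo 8, so the symbol depends only on the parity of Q. The value
    satisfies e = e^2 - 2 q, where q is 0 or 1 according to that parity and Q^(2^k) approaches q;
    the doubling formula therefore preserves V = e.\<close>
  have e: "e = (if even Q then 1 else -1)"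
  proof (cases "even Q")
    case True
    then obtain q where "Q = 2 * q" by (elim evenE)
    then have "lucas_D P Q mod 8 = 1"
      using P8 by (simp add: lucas_D_def cong_def) presburger
    then show ?thesis using True \<open>p = 2\<close> D by (simp add: e_def kronecker_prime_def)
  next
    case False
    then obtain q where "Q = 2 * q + 1" by (elim oddE)
    then have "lucas_D P Q mod 8 = 5"
      using P8 by (simp add: lucas_D_def cong_def) presburger
    then show ?thesis using False \<open>p = 2\<close> D by (simp add: e_def kronecker_prime_def)
  qed
  have "[V (2 ^ k) = e] (mod 2 ^ Suc k)"
  proof (induction k)
    case 0
    show ?case using odd_P e by (simp add: cong_iff_dvd_diff)
  next
    case (Suc k)
    have "[(V (2 ^ k))\<^sup>2 = e\<^sup>2] (mod 2 ^ Suc (Suc k))"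
      using cong_power_prime_lift[of "Suc k" "V (2 ^ k)" e 2] Suc by simp
    moreover have "[Q ^ 2 ^ k = (if even Q then 0 else 1)] (mod 2 ^ Suc k)"
    proof (cases "even Q")
      case True
      have "(2::int) ^ Suc k dvd 2 ^ (2 ^ k)" by (intro le_imp_power_dvd) (simp add: Suc_leI less_exp)
      moreover have "2 ^ (2 ^ k) dvd Q ^ (2 ^ k)" using True by (intro dvd_power_same) simp
      ultimately show ?thesis using True dvd_trans by (auto simp: cong_iff_dvd_diff)
    next
      case False
      then show ?thesis using prime_power_lift_cong[of Q 1 2 k] by (simp add: cong_iff_dvd_diff)
    qed
    then have "[2 * Q ^ 2 ^ k = 2 * (if even Q then 0 else 1)] (mod 2 ^ Suc (Suc k))"
      by (rule cong_double)
    ultimately have "[(V (2 ^ k))\<^sup>2 - 2 * Q ^ 2 ^ k = e\<^sup>2 - 2 * (if even Q then 0 else 1)] (mod 2 ^ Suc (Suc k))"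
      by (rule cong_diff)
    moreover have "e\<^sup>2 - 2 * (if even Q then 0 else 1) = e" by (simp add: e)
    ultimately show ?case using lucV_double[of P Q "2 ^ k"] by simp
  qed
  then show ?thesis using M_prime_power[of k] True by (simp add: lucU_2 e_def)
next
  case False
  then obtain h where h: "p = 2 * h + 1"
    using prime_p prime_odd_nat[of p] prime_ge_2_nat[of p] by (metis oddE order_le_imp_less_or_eq)
  define e where "e = Legendre (lucas_D P Q) (int p)"
  define r where "r = M (p ^ Suc k)"
  have e: "e = 1 \<or> e = -1" using D by (simp add: e_def Legendre_def cong_0_iff)
  have p2: "p > 2" using False prime_ge_2_nat[OF prime_p] by simp
  let ?D = "lucas_D (V (p ^ k)) (Q ^ p ^ k)"
  have "[r = lucU P Q p] (mod int p)"
    unfolding r_def M_prime_power by (intro lucU_cong V_prime_power_cong Q_prime_power_cong)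
  also have "[lucU P Q p = lucas_D P Q ^ h] (mod int p)"
    by (rule lucU_prime_cong[OF prime_p h D_nonzero])
  also have "[lucas_D P Q ^ h = e] (mod int p)"
    using euler_criterion[of p "lucas_D P Q"] prime_p p2 h by (simp add: e_def cong_sym)
  finally have re: "[r = e] (mod int p)" .
  have "[?D = lucas_D P Q] (mod int p)"
    unfolding lucas_D_def by (intro cong_diff cong_pow cong_mult V_prime_power_cong Q_prime_power_cong cong_refl)
  then have D': "\<not> int p dvd ?D" using D cong_dvd_iff by blast
  have "U (p ^ Suc k) = U (p ^ k) * r"
    unfolding r_def M_prime_power using U_mult[of "p ^ k" p] by (simp add: mult.commute)
  then have "lucas_D (V (p ^ Suc k)) (Q ^ p ^ Suc k) = ?D * r\<^sup>2"
    unfolding lucas_D_lucV by (simp add: power_mult_distrib)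
  moreover have "[lucas_D (V (p ^ Suc k)) (Q ^ p ^ Suc k) = ?D] (mod int p ^ Suc k)"
    unfolding lucas_D_def
    by (intro cong_diff cong_pow cong_mult lucV_prime_power_cong power_prime_power_cong prime_p cong_refl)
  ultimately have "[?D * r\<^sup>2 = ?D * 1] (mod int p ^ Suc k)" by simp
  then have "[r\<^sup>2 = 1] (mod int p ^ Suc k)"
    using prime_not_dvd_coprime_power[OF prime_p D'] cong_mult_lcancel by blast
  then have "int p ^ Suc k dvd (r + e) * (r - e)"
    using e by (auto simp: cong_iff_dvd_diff power2_eq_square algebra_simps)
  \<comment> \<open>r = e modulo p makes r + e = 2 e modulo p, a unit; so the sign known modulo p
    selects the square root of 1 modulo the full power.\<close>
  moreover have "\<not> int p dvd r + e"
  proof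
    assume "int p dvd r + e"
    moreover have "int p dvd r - e" using re by (simp add: cong_iff_dvd_diff)
    ultimately have "int p dvd (r + e) - (r - e)" by (rule dvd_diff)
    then have "int p dvd 2" using e by auto
    then have "int p \<le> 2" by (rule zdvd_imp_le) simp
    then show False using p2 by simp
  qed
  then have "coprime (int p ^ Suc k) (r + e)"
    using prime_not_dvd_coprime_power[OF prime_p] coprime_commute by blast
  ultimately have "int p ^ Suc k dvd r - e"
    by (simp only: coprime_dvd_mult_right_iff)
  then show ?thesis using False by (simp add: kronecker_prime_def cong_iff_dvd_diff r_def e_def)
qed

end

text \<open>For odd P and Q the entry point of 2 is 3. Its first doubling, from 3 to 6, lies below
  the levels covered by \<open>lucV_two_power_cong\<close>.\<close>

lemma lucV_6_cong:
  assumes "odd P" "odd Q"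
  shows "[lucV P Q 6 = 2] (mod 8)"
proof -
  obtain q where q: "Q = 2 * q + 1" using assms by (elim oddE)
  have "lucV P Q 3 = P * (P\<^sup>2 - 3 * Q)"
    by (simp add: numeral_3_eq_3 power2_eq_square algebra_simps)
  then have V: "lucV P Q 6 = P\<^sup>2 * (P\<^sup>2 - 3 * Q)\<^sup>2 - 2 * (Q\<^sup>2 * Q)"
    using lucV_double[of P Q 3] by (simp add: power_mult_distrib power3_eq_cube power2_eq_square mult.assoc)
  have "[lucV P Q 6 = 1 * (1 - 3 * Q)\<^sup>2 - 2 * (1 * Q)] (mod 8)"
    unfolding V by (intro cong_diff cong_mult cong_pow odd_square_cong_1 assms cong_refl)
  \<comment> \<open>(1 - 3 Q)^2 - 2 Q - 2 equals 4 q (9 q + 5), and q and 9 q + 5 have opposite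
    parity.\<close>
  moreover have "even (q * (9 * q + 5))" by simp
  then obtain r where r: "q * (9 * q + 5) = 2 * r" by (elim evenE)
  then have "1 * (1 - 3 * Q)\<^sup>2 - 2 * (1 * Q) - 2 = 8 * r"
    unfolding q by (simp add: power2_eq_square algebra_simps)
  then have "[1 * (1 - 3 * Q)\<^sup>2 - 2 * (1 * Q) = 2] (mod 8)"
    unfolding cong_iff_dvd_diff by simp
  ultimately show ?thesis by (rule cong_trans)
qed

text \<open>p divides x because y is a unit modulo p; therefore y modulo p^j determines x y modulo
  p^(j + 1). The congruence modulo p is listed separately to cover j = 0.\<close>

lemma cong_times_prime_cancel:
  fixes x y e :: int
  assumes p: "prime p" and e: "e\<^sup>2 = 1" "[y = e] (mod int p)" "[y = e] (mod int p ^ j)"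
    and xy: "[x * y = int p] (mod int p ^ Suc j)"
  shows "[x = e * int p] (mod int p ^ Suc j)"
proof -
  have pp: "prime (int p)" using p by simp
  have "[x * y = int p] (mod int p)" using xy by (rule cong_dvd_modulus) simp
  then have "int p dvd x * y" by (simp add: cong_dvd_iff)
  moreover have "\<not> int p dvd y"
  proof
    assume "int p dvd y"
    then have "int p dvd e * e" using cong_dvd_iff[OF e(2)] by simp
    then show False using e(1) pp by (simp add: power2_eq_square)
  qed
  ultimately obtain z where z: "x = int p * z" using pp by (auto simp: prime_dvd_mult_iff)
  have "int p * int p ^ j dvd (int p * z) * (y - e)"
    using e(3) by (intro mult_dvd_mono) (simp_all add: cong_iff_dvd_diff)
  then have "[x * y = x * e] (mod int p ^ Suc j)"
    unfolding cong_iff_dvd_diff right_diff_distrib[symmetric] z power_Suc .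
  from cong_trans[OF cong_sym[OF this] xy] have "[e * (x * e) = e * int p] (mod int p ^ Suc j)"
    by (intro cong_mult cong_refl)
  moreover have "e * (x * e) = e\<^sup>2 * x" by (simp add: power2_eq_square)
  ultimately show ?thesis by (simp add: e(1))
qed

lemma kronecker_prime_square:
  assumes "prime p" "\<not> int p dvd a"
  shows "(kronecker_prime a p)\<^sup>2 = 1"
  using assms by (auto simp: kronecker_prime_def Legendre_def cong_0_iff)

section \<open>Divisibility when a prime divides both parameters\<close>

lemma dvd_dualU:
  assumes "n > 1" "\<And>j. j \<le> totient n div 2 \<Longrightarrow> m dvd P ^ (totient n - 2 * j) * Q ^ j"
  shows "m dvd dualU P Q n"
proof -
  have "m dvd dual_coeff n j * P ^ (totient n - 2 * j) * Q ^ j" if "j \<le> totient n div 2" for j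
    unfolding mult.assoc using assms(2)[OF that] by (rule dvd_mult)
  then show ?thesis unfolding dualU_def using assms(1) by (auto intro: dvd_sum)
qed

text \<open>With one factor m from each P and two from each Q, every monomial collects exactly
  totient n of them.\<close>

lemma power_totient_dvd_dualU:
  assumes "n > 1" "m dvd P" "m\<^sup>2 dvd Q"
  shows "m ^ totient n dvd dualU P Q n"
proof (rule dvd_dualU[OF assms(1)])
  fix j assume j: "j \<le> totient n div 2"
  have "m ^ totient n = m ^ (totient n - 2 * j) * (m\<^sup>2) ^ j"
    using j by (simp flip: power_add power_mult)
  also have "\<dots> dvd P ^ (totient n - 2 * j) * Q ^ j"
    using assms by (intro mult_dvd_mono dvd_power_same)
  finally show "m ^ totient n dvd P ^ (totient n - 2 * j) * Q ^ j" .
qed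

text \<open>With a single factor m from each Q, the poorest monomial is the one of highest degree in
  Q, which keeps half of the weight, rounded up.\<close>

lemma power_half_totient_dvd_dualU:
  assumes "n > 1" "m dvd P" "m dvd Q"
  shows "m ^ (totient n - totient n div 2) dvd dualU P Q n"
proof (rule dvd_dualU[OF assms(1)])
  fix j assume j: "j \<le> totient n div 2"
  have "m ^ (totient n - totient n div 2) dvd m ^ (totient n - 2 * j + j)"
    using j by (intro le_imp_power_dvd) simp
  also have "\<dots> dvd P ^ (totient n - 2 * j) * Q ^ j"
    unfolding power_add using assms by (intro mult_dvd_mono dvd_power_same)
  finally show "m ^ (totient n - totient n div 2) dvd P ^ (totient n - 2 * j) * Q ^ j" .
qed

text \<open>This is the exceptional case p = 2, n = 1, where the weights give only 2^(2^k). The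
  further factor 2 is the coefficient of Q^m in V_(2 m) = V_m^2 - 2 Q^m; the square has a factor 2
  to spare.\<close>

lemma two_power_dvd_lucV:
  assumes "even P" "even Q"
  shows "2 ^ (2 ^ k + 1) dvd lucV P Q (2 ^ Suc k)"
proof (induction k)
  case 0
  have "2 * 2 dvd P * P" "2 * 2 dvd 2 * Q" using assms by (auto intro!: mult_dvd_mono)
  then have "2 * 2 dvd P * P - 2 * Q" by (rule dvd_diff)
  then show ?case by (simp add: lucV_2 power2_eq_square)
next
  case (Suc k)
  have "(2::int) ^ (2 ^ Suc k + 1) dvd (2 ^ (2 ^ k + 1))\<^sup>2"
    unfolding power_mult[symmetric] by (intro le_imp_power_dvd) simp
  also have "\<dots> dvd (lucV P Q (2 ^ Suc k))\<^sup>2" using Suc by (rule dvd_power_same)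
  finally have 1: "2 ^ (2 ^ Suc k + 1) dvd (lucV P Q (2 ^ Suc k))\<^sup>2" .
  have "2 ^ (2 ^ Suc k) dvd Q ^ 2 ^ Suc k" using assms(2) by (rule dvd_power_same)
  then have "2 * 2 ^ (2 ^ Suc k) dvd 2 * Q ^ 2 ^ Suc k" by (intro mult_dvd_mono) simp_all
  then have "2 ^ (2 ^ Suc k + 1) dvd 2 * Q ^ 2 ^ Suc k" by simp
  from dvd_diff[OF 1 this] show ?case
    using lucV_double[of P Q "2 ^ Suc k"] by simp
qed

section \<open>The entry point, ramified primes and common prime divisors\<close>

context nondegenerate_lucas_prime
begin

lemma M_two_power: "p = 2 \<Longrightarrow> M (2 ^ Suc k) = V (2 ^ k)"
  using M_prime_power[of k] by (simp add: lucU_2)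

lemma M_two_power_cong:
  assumes "p = 2" "even P" "odd Q"
  shows "[M (2 ^ Suc k) = 2] (mod 2 ^ Suc k)"
proof -
  \<comment> \<open>\<open>lucV_two_power_cong\<close> starts at index 4, that is at k = 2; the two
    smaller cases are checked directly.\<close>
  consider "k = 0" | "k = 1" | j where "k = j + 2"
    by (metis One_nat_def add_2_eq_Suc' not0_implies_Suc)
  then show ?thesis
  proof cases
    case 1
    then show ?thesis using assms M_two_power[of 0] by (simp add: cong_iff_dvd_diff)
  next
    case 2
    obtain a b where "P = 2 * a" "Q = 2 * b + 1" using assms by (metis evenE oddE)
    then have "V 2 - 2 = 4 * (a\<^sup>2 - b - 1)" by (simp add: lucV_2 power2_eq_square algebra_simps)
    then have "4 dvd V 2 - 2" by (rule dvdI)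
    then show ?thesis using 2 assms M_two_power[of 1] by (simp add: cong_iff_dvd_diff)
  next
    case 3
    have "[V (2 ^ k) = 2] (mod 2 ^ Suc k)"
      using lucV_two_power_cong[OF assms(2,3), of j] unfolding 3
      by (rule cong_dvd_modulus) (rule le_imp_power_dvd, simp)
    then show ?thesis using assms M_two_power by simp
  qed
qed

text \<open>
  The product of \<open>M (p ^ Suc k * d)\<close> over all \<open>d\<close> dividing the entry point \<open>n\<close> is a quotient of
  two Lucas numbers, and the factors with \<open>d < n\<close> fall under the generic case.
\<close>

lemma M_rank_cong_of_lucU_cong:
  assumes D: "\<not> int p dvd lucas_D P Q" and n: "n > 0" "\<not> p dvd n"
    and U: "int p dvd U n" and min: "\<And>m. 0 < m \<Longrightarrow> m < n \<Longrightarrow> \<not> int p dvd U m"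
    and j: "j \<le> Suc k"
    and R: "[lucU (V (p ^ k * n)) (Q ^ (p ^ k * n)) p = int p] (mod int p ^ Suc j)"
  shows "[M (p ^ Suc k * n) = kronecker_prime (lucas_D P Q) p * int p] (mod int p ^ Suc j)"
proof -
  let ?e = "kronecker_prime (lucas_D P Q) p"
  have fin: "finite {d. d dvd n}" using n by simp
  have "n \<noteq> 1" using U prime_gt_1_nat[OF prime_p] by auto
  have "[(\<Prod>d\<in>{d. d dvd n} - {n}. M (p ^ Suc k * d)) = (\<Prod>d\<in>{d. d dvd n} - {n}. if d = 1 then ?e else 1)]
    (mod int p ^ Suc k)"
  proof (rule cong_prod)
    fix d assume d: "d \<in> {d. d dvd n} - {n}"
    then have "d dvd n" "d \<noteq> n" by simp_all
    then have dn: "d < n" "d > 0" "\<not> p dvd d"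
      using n dvd_imp_le[of d n] dvd_trans[of p d n] by (auto intro: Nat.gr0I)
    show "[M (p ^ Suc k * d) = (if d = 1 then ?e else 1)] (mod int p ^ Suc k)"
    proof (cases "d = 1")
      case True
      then show ?thesis using M_p_power_kronecker[OF D, of k] by simp
    next
      case False
      have "\<not> int p dvd M d" using min[of d] dn dvd_trans[OF _ M_dvd_U[of d d]] by auto
      then show ?thesis using False dn M_cong_1[of d k] by simp
    qed
  qed
  also have "(\<Prod>d\<in>{d. d dvd n} - {n}. if d = 1 then ?e else 1) = ?e"
    using fin \<open>n \<noteq> 1\<close> by (subst prod.delta) auto
  finally have E: "[(\<Prod>d\<in>{d. d dvd n} - {n}. M (p ^ Suc k * d)) = ?e] (mod int p ^ Suc k)" .
  have eq: "M (p ^ Suc k * n) * (\<Prod>d\<in>{d. d dvd n} - {n}. M (p ^ Suc k * d))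
      = lucU (V (p ^ k * n)) (Q ^ (p ^ k * n)) p"
    unfolding prod_M_prime_power[OF n, symmetric] using fin by (subst prod.remove[of _ n]) auto
  show ?thesis
  proof (rule cong_times_prime_cancel[OF prime_p kronecker_prime_square[OF prime_p D]])
    show "[(\<Prod>d\<in>{d. d dvd n} - {n}. M (p ^ Suc k * d)) = ?e] (mod int p)"
      using E by (rule cong_dvd_modulus) simp
    show "[(\<Prod>d\<in>{d. d dvd n} - {n}. M (p ^ Suc k * d)) = ?e] (mod int p ^ j)"
      using E by (rule cong_dvd_modulus) (rule le_imp_power_dvd[OF j])
  qed (simp only: eq R)
qed

text \<open>Since p divides U_n, the parameters (V_n, Q^n) have discriminant divisible by p^2. For
  odd p the strong congruence for U_p thus holds from k = 0 on, also for p = 3; for p = 2 the number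
  in question is V_(2^k n), which is close to 2.\<close>

lemma M_rank_cong:
  assumes D: "\<not> int p dvd lucas_D P Q" and Q: "\<not> int p dvd Q" and n: "n > 0" "\<not> p dvd n"
    and U: "int p dvd U n" and min: "\<And>m. 0 < m \<Longrightarrow> m < n \<Longrightarrow> \<not> int p dvd U m"
  shows "[M (p ^ Suc k * n) = kronecker_prime (lucas_D P Q) p * int p] (mod int p ^ Suc k)"
    and "p = 2 \<Longrightarrow> k \<ge> 1 \<Longrightarrow>
      [M (p ^ Suc k * n) = kronecker_prime (lucas_D P Q) p * int p] (mod int p ^ (k + 2))"
    and "p > 2 \<Longrightarrow>
      [M (p ^ Suc k * n) = kronecker_prime (lucas_D P Q) p * int p] (mod int p ^ (k + 2))"
proof -
  note aux = M_rank_cong_of_lucU_cong[OF D n U min]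
  interpret n: nondegenerate_lucas "V n" "Q ^ n" by (rule nondegenerate_lucas_V[OF n(1)])
  have Dn: "(int p)\<^sup>2 dvd lucas_D (V n) (Q ^ n)"
    unfolding lucas_D_lucV using U by (intro dvd_mult dvd_power_same)
  have Qn: "\<not> int p dvd Q ^ n" using Q prime_int_p prime_dvd_power by blast
  have odd: "[lucU (V (p ^ k * n)) (Q ^ (p ^ k * n)) p = int p] (mod int p ^ (k + 2))" if "p > 2"
  proof -
    obtain h where h: "p = 2 * h + 1"
      using prime_p prime_odd_nat[of p] \<open>p > 2\<close> by (metis oddE)
    interpret O: odd_prime_dividing_D "V n" "Q ^ n" p h
    proof
      show "int p dvd lucas_D (V n) (Q ^ n)"
        using Dn by (rule dvd_trans[rotated]) (simp add: power2_eq_square)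
    qed (use prime_p h Qn n.D_nonzero in auto)
    show ?thesis using O.lucU_p_cong_strong[of k] Dn
      by (simp add: lucV_mult mult.commute flip: power_mult)
  qed
  have two: "[lucU (V (p ^ k * n)) (Q ^ (p ^ k * n)) p = int p] (mod int p ^ (k + 2))" if "p = 2" "k \<ge> 1"
  proof -
    have oddPQ: "odd P" "odd Q" "odd n" using that D Q n by (auto simp: lucas_D_def)
    have "even (lucas_D (V n) (Q ^ n))" using Dn \<open>p = 2\<close> by auto
    then have eV: "even (V n)" by (simp add: lucas_D_def)
    have "[V (2 ^ k * n) = 2] (mod 2 ^ (k + 2))"
    proof (cases "k = 1")
      case True
      \<comment> \<open>U_3 = P^2 - Q is even for odd P and Q, so the entry point is at most 3, and
        it is neither 1 nor even.\<close>
      have "even (U 3)" using oddPQ by (simp add: numeral_3_eq_3)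
      then have "n \<le> 3" using min[of 3] \<open>p = 2\<close> by force
      moreover have "n \<noteq> 1" using U \<open>p = 2\<close> by auto
      ultimately have "n = 3" using oddPQ(3) by presburger
      then show ?thesis using True lucV_6_cong[OF oddPQ(1,2)] by simp
    next
      case False
      define i where "i = k - 2"
      have i: "k = i + 2" using False that(2) by (simp add: i_def)
      have "[lucV (V n) (Q ^ n) (2 ^ (i + 2)) = 2] (mod 2 ^ (i + 4))"
        using eV oddPQ by (intro lucV_two_power_cong) simp_all
      moreover have "k + 2 = i + 4" "2 ^ k * n = n * 2 ^ (i + 2)" by (simp_all add: i)
      ultimately show ?thesis by (simp only: lucV_mult)
    qed
    then show ?thesis using \<open>p = 2\<close> by (simp add: lucU_2)
  qed
  show "[M (p ^ Suc k * n) = kronecker_prime (lucas_D P Q) p * int p] (mod int p ^ (k + 2))" if "p > 2"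
    using aux[of "Suc k" k] odd[OF that] by simp
  show "[M (p ^ Suc k * n) = kronecker_prime (lucas_D P Q) p * int p] (mod int p ^ (k + 2))"
    if "p = 2" "k \<ge> 1"
    using aux[of "Suc k" k] two[OF that] by simp
  have "[lucU (V (p ^ k * n)) (Q ^ (p ^ k * n)) p = int p] (mod int p ^ Suc k)"
  proof (cases "p = 2 \<and> k = 0")
    case True
    have "even (lucas_D (V n) (Q ^ n))" using Dn True by auto
    then have eV: "even (V n)" by (simp add: lucas_D_def)
    then show ?thesis using True by (simp add: lucU_2 cong_iff_dvd_diff)
  next
    case False
    then have "[lucU (V (p ^ k * n)) (Q ^ (p ^ k * n)) p = int p] (mod int p ^ (k + 2))"
      using two odd prime_ge_2_nat[OF prime_p] by (cases "p = 2") auto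
    then show ?thesis by (rule cong_dvd_modulus) (rule le_imp_power_dvd, simp)
  qed
  then show "[M (p ^ Suc k * n) = kronecker_prime (lucas_D P Q) p * int p] (mod int p ^ Suc k)"
    using aux[of k k] by simp
qed

text \<open>The exponent of p is \<open>Suc k\<close>, so the bounds on \<open>k\<close> are lower
  by 1 than the bounds on the exponent in the theorem.\<close>

lemma M_ramified:
  assumes D: "int p dvd lucas_D P Q" and Q: "\<not> int p dvd Q"
  shows "[M (p ^ Suc k) = int p] (mod int p ^ Suc k)"
    and "p = 2 \<Longrightarrow> k \<ge> 2 \<Longrightarrow> [M (2 ^ Suc k) = 2] (mod 2 ^ (k + 2))"
    and "p > 2 \<Longrightarrow> p > 3 \<or> k \<ge> 1 \<Longrightarrow> [M (p ^ Suc k) = int p] (mod int p ^ (k + 2))"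
proof -
  have PQ: "even P" "odd Q" if "p = 2" using D Q that by (auto simp: lucas_D_def)
  have loc: "\<exists>h. odd_prime_dividing_D P Q p h" if "p > 2"
    using prime_p prime_odd_nat[of p] that D Q D_nonzero
    by (metis oddE odd_prime_dividing_D.intro)
  show "[M (p ^ Suc k) = int p] (mod int p ^ Suc k)"
  proof (cases "p = 2")
    case True
    then show ?thesis using M_two_power_cong[OF True PQ] by simp
  next
    case False
    then have "p > 2" using prime_ge_2_nat[OF prime_p] by simp
    then show ?thesis
      unfolding M_prime_power using loc odd_prime_dividing_D.lucU_p_cong by blast
  qed
  show "[M (2 ^ Suc k) = 2] (mod 2 ^ (k + 2))" if "p = 2" "k \<ge> 2"
  proof -
    obtain j where j: "k = j + 2" using \<open>k \<ge> 2\<close> by (metis add.commute le_Suc_ex)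
    then have "k + 2 = j + 4" by simp
    then show ?thesis
      using lucV_two_power_cong[OF PQ[OF that(1)], of j] M_two_power[OF that(1), of k]
      by (simp only: j)
  qed
  show "[M (p ^ Suc k) = int p] (mod int p ^ (k + 2))" if "p > 2" "p > 3 \<or> k \<ge> 1"
    unfolding M_prime_power using loc[OF that(1)] that(2) odd_prime_dividing_D.lucU_p_cong_strong by blast
qed

lemma totient_prime_power_mult:
  assumes "coprime p n"
  shows "totient (p ^ Suc k * n) = p ^ k * ((p - 1) * totient n)"
  using assms prime_p by (simp add: totient_mult_coprime totient_prime_power_Suc del: power_Suc)

text \<open>If 2 v_p(P) <= v_p(Q), the full weight totient N counts. Otherwise half of totient N =
  p^k (p - 1) totient n must reach p^k, that is (p - 1) totient n >= 2; for n prime to p this fails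
  exactly when p = 2 and n = 1.\<close>

lemma M_dvd_of_dvd_gcd:
  assumes PQ: "P \<noteq> 0" "int p dvd P" "int p dvd Q" and n: "n > 0" "coprime p n"
    and not: "\<not> (2 * multiplicity (int p) P > multiplicity (int p) Q \<and> p = 2 \<and> n = 1)"
  shows "int p ^ (p ^ k) dvd M (p ^ Suc k * n)"
proof -
  let ?N = "p ^ Suc k * n"
  have N: "?N > 1"
    using prime_gt_1_nat[OF prime_p] n
    by (metis Suc_lessI less_1_mult mult.right_neutral one_less_power zero_less_Suc One_nat_def)
  have t: "totient ?N = p ^ k * ((p - 1) * totient n)" by (rule totient_prime_power_mult[OF n(2)])
  have pt: "(p - 1) * totient n > 0" using prime_gt_1_nat[OF prime_p] n by simp
  show ?thesis
  proof (cases "2 * multiplicity (int p) P > multiplicity (int p) Q")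
    case False
    let ?a = "multiplicity (int p) P"
    have a: "?a \<ge> 1" using PQ prime_int_p by (simp add: Suc_leI prime_multiplicity_gt_zero_iff)
    have "(int p ^ ?a) ^ totient ?N dvd M ?N"
    proof (rule power_totient_dvd_dualU[OF N multiplicity_dvd])
      show "(int p ^ ?a)\<^sup>2 dvd Q"
        unfolding power_mult[symmetric] using False by (intro multiplicity_dvd') simp
    qed
    moreover have "1 * (p ^ k * 1) \<le> ?a * (p ^ k * ((p - 1) * totient n))"
      using a pt by (intro mult_le_mono order_refl) (simp_all only: Suc_le_eq One_nat_def)
    then have "p ^ k \<le> ?a * totient ?N" unfolding t by simp
    then have "int p ^ (p ^ k) dvd (int p ^ ?a) ^ totient ?N"
      unfolding power_mult[symmetric] by (rule le_imp_power_dvd)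
    ultimately show ?thesis by (rule dvd_trans[rotated])
  next
    case True
    have "(p - 1) * totient n \<ge> 2"
    proof (cases "p = 2")
      case True
      then have "n \<noteq> 1" "n \<noteq> 2" using not \<open>2 * multiplicity (int p) P > multiplicity (int p) Q\<close> n by auto
      then have "totient n > 1" using n by (intro totient_gt_1) simp
      then show ?thesis using True by simp
    next
      case False
      then have "p - 1 \<ge> 2" using prime_ge_2_nat[OF prime_p] by simp
      moreover have "totient n \<ge> 1" using n by (simp add: Suc_leI)
      ultimately show ?thesis using mult_le_mono by fastforce
    qed
    then have "p ^ k * 2 \<le> totient ?N" unfolding t by (rule mult_le_mono2)
    then have "p ^ k \<le> totient ?N - totient ?N div 2" by linarith
    then have "int p ^ (p ^ k) dvd int p ^ (totient ?N - totient ?N div 2)" by (rule le_imp_power_dvd)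
    also have "\<dots> dvd M ?N" by (rule power_half_totient_dvd_dualU[OF N PQ(2,3)])
    finally show ?thesis .
  qed
qed

lemma dvd_U_iff: "dvd_U P Q p m \<longleftrightarrow> int p dvd U m"
  unfolding dvd_U_def of_int_lucU[OF D_nonzero, symmetric] of_int_eq_iff by auto

text \<open>A missing entry point is encoded as 0, which n > 0 rules out, so equality with n amounts
  to existence and minimality.\<close>

lemma entry_point_U_iff:
  assumes "n > 0"
  shows "n = entry_point_U P Q p \<longleftrightarrow> int p dvd U n \<and> (\<forall>m. 0 < m \<and> m < n \<longrightarrow> \<not> int p dvd U m)"
proof
  assume n: "n = entry_point_U P Q p"
  then have ex: "\<exists>m\<ge>1. int p dvd U m" and eq: "n = (LEAST m. m \<ge> 1 \<and> int p dvd U m)"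
    using assms unfolding entry_point_U_def dvd_U_iff by (auto split: if_splits)
  have "int p dvd U n" unfolding eq using LeastI_ex[OF ex] by simp
  moreover have "\<not> int p dvd U m" if "0 < m" "m < n" for m
    using not_less_Least[of m "\<lambda>m. m \<ge> 1 \<and> int p dvd U m"] that eq by auto
  ultimately show "int p dvd U n \<and> (\<forall>m. 0 < m \<and> m < n \<longrightarrow> \<not> int p dvd U m)" by blast
next
  assume *: "int p dvd U n \<and> (\<forall>m. 0 < m \<and> m < n \<longrightarrow> \<not> int p dvd U m)"
  have "(LEAST m. m \<ge> 1 \<and> int p dvd U m) = n"
    using * assms by (intro Least_equality) (auto simp: not_less[symmetric])
  then show "n = entry_point_U P Q p"
    using * assms unfolding entry_point_U_def dvd_U_iff by (auto simp: Suc_le_eq)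
qed

end

section \<open>Assembly of the congruences\<close>

lemma int_valued_cong_of_int: "int_valued_cong (of_int x) a m \<longleftrightarrow> [x = a] (mod m)"
  by (auto simp: int_valued_cong_def)

theorem theorem2p1:
  fixes P Q :: int and p n :: nat
  assumes "P \<noteq> 0" and "Q \<noteq> 0" and "lucas_D P Q \<noteq> 0"
    and "nondegenerate_U P Q"
    and "prime p" and "n \<ge> 1" and "coprime p n"
  shows
    "(\<not> int p dvd gcd P Q \<longrightarrow>
      (int p dvd lucas_D P Q \<longrightarrow>
        (\<forall>k\<ge>1. int_valued_cong (moebius_dual_U P Q (p ^ k * n))
                 (if n = 1 then int p else 1) (int p ^ k)) \<and>
        (p = 2 \<longrightarrow>
          (n = 1 \<longrightarrow> (\<forall>k\<ge>3. int_valued_cong (moebius_dual_U P Q (2 ^ k)) 2 (2 ^ (k + 1)))) \<and>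
          (n > 1 \<longrightarrow> (\<forall>k\<ge>2. int_valued_cong (moebius_dual_U P Q (2 ^ k * n)) 1 (2 ^ (k + 1))))) \<and>
        (p > 2 \<and> n = 1 \<longrightarrow>
          (p = 3 \<longrightarrow>
            (\<forall>k\<ge>2. int_valued_cong (moebius_dual_U P Q (p ^ k)) (int p) (int p ^ (k + 1)))) \<and>
          (p > 3 \<longrightarrow>
            (\<forall>k\<ge>1. int_valued_cong (moebius_dual_U P Q (p ^ k)) (int p) (int p ^ (k + 1)))))) \<and>
      (\<not> int p dvd lucas_D P Q \<longrightarrow>
        (n \<noteq> entry_point_U P Q p \<longrightarrow>
          (\<forall>k\<ge>1. int_valued_cong (moebius_dual_U P Q (p ^ k * n))
                   (if n = 1 then kronecker_prime (lucas_D P Q) p else 1) (int p ^ k))) \<and>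
        (n = entry_point_U P Q p \<longrightarrow>
          (\<forall>k\<ge>1. int_valued_cong (moebius_dual_U P Q (p ^ k * n))
                   (kronecker_prime (lucas_D P Q) p * int p) (int p ^ k)) \<and>
          (p = 2 \<longrightarrow>
            (\<forall>k\<ge>2. int_valued_cong (moebius_dual_U P Q (p ^ k * n))
                     (kronecker_prime (lucas_D P Q) p * int p) (int p ^ (k + 1)))) \<and>
          (p > 2 \<longrightarrow>
            (\<forall>k\<ge>1. int_valued_cong (moebius_dual_U P Q (p ^ k * n))
                     (kronecker_prime (lucas_D P Q) p * int p) (int p ^ (k + 1))))))) \<and>
     (int p dvd gcd P Q \<longrightarrow>
      (\<not> (2 * multiplicity (int p) P > multiplicity (int p) Q \<and> p = 2 \<and> n = 1) \<longrightarrow>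
        (\<forall>k\<ge>1. int_valued_cong (moebius_dual_U P Q (p ^ k * n)) 0 (int p ^ (p ^ (k - 1))))) \<and>
      (2 * multiplicity (int p) P > multiplicity (int p) Q \<and> p = 2 \<and> n = 1 \<longrightarrow>
        (\<forall>k\<ge>2. int_valued_cong (moebius_dual_U P Q (2 ^ k)) 0 (2 ^ (2 ^ (k - 2) + 1)))))"
proof -
  interpret nondegenerate_lucas_prime P Q p
    using assms by unfold_locales
  have n: "n > 0" "\<not> p dvd n"
    using assms(6,7) prime_p by (auto simp: prime_gt_1_nat coprime_absorb_left)
  have int_M: "int_valued_cong (moebius_dual_U P Q m) a b \<longleftrightarrow> [M m = a] (mod b)" if "m > 0" for m a b
    using moebius_dual_U_eq_dualU[OF Q_nonzero D_nonzero nondegenerate that]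
    by (simp add: int_valued_cong_of_int)
  have pos: "p ^ k * n > 0" "p ^ k > 0" for k using n p_pos by simp_all
  have pos2: "(2::nat) ^ k * n > 0" "(2::nat) ^ k > 0" for k using n by simp_all
  show ?thesis
    unfolding int_M[OF pos(1)] int_M[OF pos(2)] int_M[OF pos2(1)] int_M[OF pos2(2)]
  proof (intro conjI impI; (elim conjE)?)
    assume gcd: "\<not> int p dvd gcd P Q" and D: "int p dvd lucas_D P Q"
    have Q: "\<not> int p dvd Q"
    proof
      assume Q: "int p dvd Q"
      then have "int p dvd lucas_D P Q + 4 * Q" using D by simp
      then have "int p dvd P\<^sup>2" by (simp add: lucas_D_def)
      then have "int p dvd P" using prime_int_p prime_dvd_power by blast
      then show False using Q gcd by simp
    qed
    have M: "\<not> int p dvd M n" if "n > 1"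
      using dvd_M_imp_rank[OF prime_p that n(2) gcd] D by blast
    show "\<forall>k\<ge>1. [M (p ^ k * n) = (if n = 1 then int p else 1)] (mod int p ^ k)"
    proof (intro allI impI)
      fix k :: nat assume "k \<ge> 1"
      then obtain j where k: "k = Suc j" by (cases k) auto
      show "[M (p ^ k * n) = (if n = 1 then int p else 1)] (mod int p ^ k)"
        using M_ramified(1)[OF D Q, of j] M_cong_1[OF _ n(2) M, of j] n(1) unfolding k
        by (cases "n = 1") auto
    qed
    show "\<forall>k\<ge>3. [M (2 ^ k) = 2] (mod 2 ^ (k + 1))" if "p = 2"
    proof (intro allI impI)
      fix k :: nat assume "k \<ge> 3"
      then obtain j where "k = Suc j" "j \<ge> 2" by (cases k) auto
      then show "[M (2 ^ k) = 2] (mod 2 ^ (k + 1))"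
        using M_ramified(2)[OF D Q that, of j] by simp
    qed
    show "\<forall>k\<ge>2. [M (2 ^ k * n) = 1] (mod 2 ^ (k + 1))" if "p = 2" "n > 1"
    proof (intro allI impI)
      fix k :: nat assume "k \<ge> 2"
      then obtain j where k: "k = j + 2" by (metis add.commute le_Suc_ex)
      have "even P" "odd Q" using D Q that by (auto simp: lucas_D_def)
      then have "[M (2 ^ (j + 2) * n) = 1] (mod 2 ^ (j + 3))"
        using that n M by (intro M_two_power_cong_1) auto
      moreover have "k + 1 = j + 3" using k by simp
      ultimately show "[M (2 ^ k * n) = 1] (mod 2 ^ (k + 1))" by (simp only: k)
    qed
    show "\<forall>k\<ge>2. [M (p ^ k) = int p] (mod int p ^ (k + 1))" if "p > 2"
    proof (intro allI impI)
      fix k :: nat assume "k \<ge> 2"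
      then obtain j where "k = Suc j" "j \<ge> 1" by (cases k) auto
      then show "[M (p ^ k) = int p] (mod int p ^ (k + 1))"
        using M_ramified(3)[OF D Q that, of j] by simp
    qed
    show "\<forall>k\<ge>1. [M (p ^ k) = int p] (mod int p ^ (k + 1))" if "p > 2" "p > 3"
    proof (intro allI impI)
      fix k :: nat assume "k \<ge> 1"
      then obtain j where "k = Suc j" by (cases k) auto
      then show "[M (p ^ k) = int p] (mod int p ^ (k + 1))"
        using M_ramified(3)[OF D Q that(1), of j] that(2) by simp
    qed
  next
    assume gcd: "\<not> int p dvd gcd P Q" and D: "\<not> int p dvd lucas_D P Q"
    let ?e = "kronecker_prime (lucas_D P Q) p"
    show "\<forall>k\<ge>1. [M (p ^ k * n) = (if n = 1 then ?e else 1)] (mod int p ^ k)"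
      if "n \<noteq> entry_point_U P Q p"
    proof (intro allI impI)
      fix k :: nat assume "k \<ge> 1"
      then obtain j where k: "k = Suc j" by (cases k) auto
      \<comment> \<open>By contraposition: for n > 1, p dividing \<open>M n\<close> forces n to be
        the entry point.\<close>
      have "\<not> int p dvd M n" if "n > 1"
        using dvd_M_imp_rank[OF prime_p that n(2) gcd] \<open>n \<noteq> entry_point_U P Q p\<close> entry_point_U_iff[OF n(1)]
        by blast
      then show "[M (p ^ k * n) = (if n = 1 then ?e else 1)] (mod int p ^ k)"
        using M_p_power_kronecker[OF D, of j] M_cong_1[OF _ n(2), of j] n(1) unfolding k
        by (cases "n = 1") auto
    qed
    have rank: "int p dvd U n" "\<And>m. 0 < m \<Longrightarrow> m < n \<Longrightarrow> \<not> int p dvd U m" "\<not> int p dvd Q"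
      if "n = entry_point_U P Q p"
    proof -
      from that show U: "int p dvd U n" and "\<And>m. 0 < m \<Longrightarrow> m < n \<Longrightarrow> \<not> int p dvd U m"
        using entry_point_U_iff[OF n(1)] by blast+
      show "\<not> int p dvd Q"
        using prime_not_dvd_lucU_of_dvd_Q[OF prime_p, of Q P n] gcd U n(1) by auto
    qed
    note rank_cong = M_rank_cong[OF D rank(3) n rank(1,2)]
    show "\<forall>k\<ge>1. [M (p ^ k * n) = ?e * int p] (mod int p ^ k)" if z: "n = entry_point_U P Q p"
    proof (intro allI impI)
      fix k :: nat assume "k \<ge> 1"
      then obtain j where "k = Suc j" by (cases k) auto
      then show "[M (p ^ k * n) = ?e * int p] (mod int p ^ k)"
        using rank_cong(1)[OF z z z] by blast
    qed
    show "\<forall>k\<ge>2. [M (p ^ k * n) = ?e * int p] (mod int p ^ (k + 1))"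
      if z: "n = entry_point_U P Q p" and "p = 2"
    proof (intro allI impI)
      fix k :: nat assume "k \<ge> 2"
      then obtain j where "k = Suc j" "j \<ge> 1" by (cases k) auto
      then show "[M (p ^ k * n) = ?e * int p] (mod int p ^ (k + 1))"
        using rank_cong(2)[OF z z z _ _ \<open>p = 2\<close>, of j] by simp
    qed
    show "\<forall>k\<ge>1. [M (p ^ k * n) = ?e * int p] (mod int p ^ (k + 1))"
      if z: "n = entry_point_U P Q p" and "p > 2"
    proof (intro allI impI)
      fix k :: nat assume "k \<ge> 1"
      then obtain j where "k = Suc j" by (cases k) auto
      then show "[M (p ^ k * n) = ?e * int p] (mod int p ^ (k + 1))"
        using rank_cong(3)[OF z z z _ _ \<open>p > 2\<close>, of j] by simp
    qed
  next
    assume gcd: "int p dvd gcd P Q"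
    show "\<forall>k\<ge>1. [M (p ^ k * n) = 0] (mod int p ^ (p ^ (k - 1)))"
      if "\<not> (2 * multiplicity (int p) P > multiplicity (int p) Q \<and> p = 2 \<and> n = 1)"
    proof (intro allI impI)
      fix k :: nat assume "k \<ge> 1"
      then obtain j where "k = Suc j" by (cases k) auto
      then show "[M (p ^ k * n) = 0] (mod int p ^ (p ^ (k - 1)))"
        using M_dvd_of_dvd_gcd[OF assms(1) _ _ n(1) assms(7) that, of j] gcd by (simp add: cong_0_iff)
    qed
    show "\<forall>k\<ge>2. [M (2 ^ k) = 0] (mod 2 ^ (2 ^ (k - 2) + 1))" if "p = 2"
    proof (intro allI impI)
      fix k :: nat assume "k \<ge> 2"
      then obtain j where k: "k = Suc (Suc j)" by (metis add_2_eq_Suc le_Suc_ex)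
      have "2 ^ (2 ^ j + 1) dvd V (2 ^ Suc j)"
        using gcd that by (intro two_power_dvd_lucV) simp_all
      then show "[M (2 ^ k) = 0] (mod 2 ^ (2 ^ (k - 2) + 1))"
        using M_two_power[OF that, of "Suc j"] k by (simp add: cong_0_iff)
    qed
  qed
qed

end
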